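(* Let $\mathbb F$ be an algebraically closed field and let $q\in\mathbb F$ be nonzero and not a root of unity. Let $A,B$ denote a Leonard pair over $\mathbb F$ of $q$-Racah type, with feasible sequence $(a,b,c,d)$, $d\ge1$. Let $\{v_n\}_{n=0}^d$ denote a basis for the underlying vector space $V$. Then the following are equivalent: (i) with respect to $\{v_n\}_{n=0}^d$, $A$ and $B$ are represented by the tridiagonal matrices in ${\rm Mat}_{d+1}(\mathbb F)$ with entries $$\begin{array}{c|ccc}\text{element}&(n,n-1)\text{-entry}&(n,n)\text{-entry}&(n-1,n)\text{-entry}\\ \hline A&c^{-1}(1-q^{-2n})&(a+a^{-1})q^{d-2n}&c(1-q^{2d-2n+2})\\ B&q^{-d-1}(1-q^{2n})&(b+b^{-1})q^{2n-d}&q^{d+1}(1-q^{2n-2d-2})\end{array}$$ (off-diagonal entries for $1\le n\le d$, diagonal entries for $0\le n\le d$); (ii) the basis $\{q^{-n}b^{-n}v_n\}_{n=0}^d$ is a $[1,3,0,2]$-basis of $V$, where $V$ carries the unique $\boxtimes_q$-module structure that makes it an evaluation module with evaluation parameter $t=abc^{-1}$ and for which $A=ax_{01}+a^{-1}x_{12}$ and $B=bx_{23}+b^{-1}x_{30}$ on $V$.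
   Context: Algebras are associative with 1. $[n]_q=(q^n-q^{-n})/(q-q^{-1})$ and $\mathbb Z_4=\mathbb Z/4\mathbb Z$. The $q$-tetrahedron algebra $\boxtimes_q$ is the $\mathbb F$-algebra with generators (called the standard generators) $\{x_{ij}\mid i,j\in\mathbb Z_4,\ j-i=1\text{ or }j-i=2\}$ and relations: (i) $x_{ij}x_{ji}=1$ if $j-i=2$; (ii) $\frac{qx_{ij}x_{jk}-q^{-1}x_{jk}x_{ij}}{q-q^{-1}}=1$ if $(j-i,k-j)$ is one of $(1,1),(1,2),(2,1)$; (iii) $x_{ij}^3x_{k\ell}-[3]_qx_{ij}^2x_{k\ell}x_{ij}+[3]_qx_{ij}x_{k\ell}x_{ij}^2-x_{k\ell}x_{ij}^3=0$ if $j-i=k-j=\ell-k=1$. Known fact: on a finite-dimensional irreducible $\boxtimes_q$-module $V$ there are $d\in\mathbb N$ (the diameter) and $\varepsilon\in\{1,-1\}$ (the type) such that each standard generator is diagonalizable with set of distinct eigenvalues $\{\varepsilon q^{d-2n}\mid 0\le n\le d\}$. Let $V$ have type 1. For distinct $i,j\in\mathbb Z_4$ the decomposition $[i,j]$ of $V$ is the sequence of subspaces $\{V_n\}_{n=0}^d$ (with $V=\bigoplus_n V_n$) such that: if $j-i\in\{1,2\}$, $V_n$ is the eigenspace of $x_{ij}$ with eigenvalue $q^{d-2n}$; if $j-i=3$, $[i,j]$ is the inversion (reversed sequence) of $[j,i]$. The shape $(\dim V_n)_{n=0}^d$ does not depend on $i,j$. For $i\in\mathbb Z_4$ the flag $[i]$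 on $V$ has $n$th component $V_0+\cdots+V_n$, where $\{V_n\}$ is the decomposition $[i,j]$; this is known not to depend on $j\ne i$. The trivial $\boxtimes_q$-module is the one-dimensional module on which every standard generator acts as the identity. An evaluation module for $\boxtimes_q$ is a nontrivial finite-dimensional irreducible $\boxtimes_q$-module of type 1 and shape $(1,1,\dots,1)$ (so $d\ge1$, $\dim V=d+1$). For mutually distinct $i,j,k,\ell\in\mathbb Z_4$, an $[i,j,k,\ell]$-basis for an evaluation module $V$ is a basis $\{u_n\}_{n=0}^d$ such that $u_n$ is in component $n$ of the decomposition $[k,\ell]$ for $0\le n\le d$, and $\sum_{n=0}^du_n$ is in component $0$ of the flag $[j]$. Matrices in ${\rm Mat}_{d+1}(\mathbb F)$ have rows and columns indexed by $0,\dots,d$; $M$ represents $A$ with respect to a basis $\{v_n\}_{n=0}^d$ when $Av_n=\sum_i M_{in}v_i$. Entries not mentioned below are $0$. A subscript $q^{-1}$ means that $q$ is replaced by $q^{-1}$ in the definition (and similarly $t^{-1}$ as argument). - $Z$: $(i,j)$-entry $\delta_{i+j,d}$. - $K_q$: diagonal, $(i,i)$-entry $q^{d-2i}$. - $E_q$: $(i,i)$-entry $q^{2i-d}$; $(i-1,i)$-entry $q^d-q^{2i-2-d}$. - $G_q(t)$: $(i,i)$-entry $q^{2i-d}$; $(i-1,i)$-entry $(q^d-q^{2i-2-d})(1-tq^{d-2i+1})$. - $L_q(t)$: $(i,i)$-entry $q^{2i-d}$; $(i-1,i)$-entry $(q^d-q^{2i-2-d})(1-tq^{d-2i+1})^{-1}$.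 - $S_q(t)$: $(i-1,i)$-entry $(q^d-q^{2i-d-2})(1-tq^{2i-d-1})$; $(i,i-1)$-entry $(q^{2i-d}-q^{-d})q^{2i-d-1}t$; $(i,i)$-entry $q^d-(q^{2i-d}-q^{-d})q^{2i-d-1}t-(q^d-q^{2i-d})(1-tq^{2i-d+1})$. For an integer $d\ge1$ and a nonzero $t\in\mathbb F$ not among $\{q^{d-2n+1}\}_{n=1}^d$, $\mathbf V_d(t)$ is the evaluation module for $\boxtimes_q$ having a basis with respect to which the standard generators are represented by: $x_{01}: ZS_{q^{-1}}(t^{-1})Z$, $x_{12}: E_q$, $x_{23}: K_q$, $x_{30}: ZG_{q^{-1}}(t)Z$, $x_{02}: L_q(t)$, $x_{13}: (ZE_{q^{-1}}Z)^{-1}$, $x_{20}: (L_q(t))^{-1}$, $x_{31}: ZE_{q^{-1}}Z$. Every evaluation module $V$ of diameter $d$ is isomorphic to $\mathbf V_d(t)$ for a unique such $t$, called the evaluation parameter of $V$. Leonard pairs. A Leonard pair on a finite-dimensional nonzero $\mathbb F$-vector space $V$ (the underlying vector space) is an ordered pair $A,B\in{\rm End}(V)$ such that there is a basis of $V$ in which $A$ is diagonal and $B$ is irreducible tridiagonal, and a basis in which $B$ is diagonal and $A$ is irreducible tridiagonal (irreducible: all subdiagonal and superdiagonal entries nonzero). For nonzero $a,b,c\in\mathbb F$ and an integer $d\ge1$, $(a,b,c,d)$ is feasible when: (i) neither of $a^2,b^2$ is among $q^{2d-2},q^{2d-4},\dots,q^{2-2d}$; (ii) none of $abc,a^{-1}bc,ab^{-1}c,abc^{-1}$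 is among $q^{d-1},q^{d-3},\dots,q^{1-d}$. Put $\theta_n=aq^{2n-d}+a^{-1}q^{d-2n}$, $\theta^*_n=bq^{2n-d}+b^{-1}q^{d-2n}$ ($0\le n\le d$) and, for $1\le n\le d$, $\varphi_n=a^{-1}b^{-1}q^{d+1}(q^n-q^{-n})(q^{n-d-1}-q^{d-n+1})(q^{-n}-abcq^{n-d-1})(q^{-n}-abc^{-1}q^{n-d-1})$, $\phi_n=ab^{-1}q^{d+1}(q^n-q^{-n})(q^{n-d-1}-q^{d-n+1})(q^{-n}-a^{-1}bcq^{n-d-1})(q^{-n}-a^{-1}bc^{-1}q^{n-d-1})$. For feasible $(a,b,c,d)$ there is (known) a Leonard pair $A,B$, unique up to isomorphism (simultaneous conjugation by a linear bijection), such that: in one basis $A$ is lower bidiagonal with $(n,n)$-entry $\theta_n$ and all subdiagonal entries $1$, and $B$ is upper bidiagonal with $(n,n)$-entry $\theta^*_n$ and $(n-1,n)$-entry $\varphi_n$; in another basis $A$ is lower bidiagonal with $(n,n)$-entry $\theta_{d-n}$ and all subdiagonal entries $1$, and $B$ is upper bidiagonal with $(n,n)$-entry $\theta_n^*$ and $(n-1,n)$-entry $\phi_n$. This Leonard pair (and any isomorphic one) is said to correspond to $(a,b,c,d)$, and $(a,b,c,d)$ is called a feasible sequence for it. Leonard pairs arising in this way are said to have $q$-Racah type. For such a pair the $\boxtimes_q$-module structure on $V$ described in (ii) exists and is unique. *)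

theory Defs
  imports
    "HOL-Library.Numeral_Type"
    "HOL-Computational_Algebra.Polynomial"
    "Jordan_Normal_Form.Gauss_Jordan_Elimination"
begin

section \<open>Matrices\<close>

text \<open>An entry given by a formula in \<open>n\<close> at position (n-1,n) or (n,n-1), for 1 \<le> n \<le> d, appears
  under the guard j = i+1 with n = j, respectively i = j+1 with n = i. A matrix with subscript
  \<open>1/q\<close> is obtained by passing \<open>inverse q\<close>.\<close>

definition Z_mat :: "nat \<Rightarrow> 'a::field mat" where
  "Z_mat d = mat (d+1) (d+1) (\<lambda>(i,j). if i + j = d then 1 else 0)"

definition K_mat :: "nat \<Rightarrow> 'a::field \<Rightarrow> 'a mat" where
  "K_mat d q = mat (d+1) (d+1) (\<lambda>(i,j).
     if i = j then q powi (int d - 2 * int i) else 0)"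

definition E_mat :: "nat \<Rightarrow> 'a::field \<Rightarrow> 'a mat" where
  "E_mat d q = mat (d+1) (d+1) (\<lambda>(i,j).
     if i = j then q powi (2 * int i - int d)
     else if j = i + 1 then q powi (int d) - q powi (2 * int j - 2 - int d)
     else 0)"

definition G_mat :: "nat \<Rightarrow> 'a::field \<Rightarrow> 'a \<Rightarrow> 'a mat" where
  "G_mat d q t = mat (d+1) (d+1) (\<lambda>(i,j).
     if i = j then q powi (2 * int i - int d)
     else if j = i + 1 then
       (q powi (int d) - q powi (2 * int j - 2 - int d)) *
       (1 - t * q powi (int d - 2 * int j + 1))
     else 0)"

definition L_mat :: "nat \<Rightarrow> 'a::field \<Rightarrow> 'a \<Rightarrow> 'a mat" where
  "L_mat d q t = mat (d+1) (d+1) (\<lambda>(i,j).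
     if i = j then q powi (2 * int i - int d)
     else if j = i + 1 then
       (q powi (int d) - q powi (2 * int j - 2 - int d)) *
       inverse (1 - t * q powi (int d - 2 * int j + 1))
     else 0)"

definition S_mat :: "nat \<Rightarrow> 'a::field \<Rightarrow> 'a \<Rightarrow> 'a mat" where
  "S_mat d q t = mat (d+1) (d+1) (\<lambda>(i,j).
     if i = j then
       q powi (int d)
       - (q powi (2 * int i - int d) - q powi (- int d)) * q powi (2 * int i - int d - 1) * t
       - (q powi (int d) - q powi (2 * int i - int d)) * (1 - t * q powi (2 * int i - int d + 1))
     else if j = i + 1 then
       (q powi (int d) - q powi (2 * int j - int d - 2)) * (1 - t * q powi (2 * int j - int d - 1))
     else if i = j + 1 then
       (q powi (2 * int i - int d) - q powi (- int d)) * q powi (2 * int i - int d - 1) * t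
     else 0)"

text \<open>\<open>the (mat_inverse M)\<close> is the matrix inverse; it is only applied to upper or lower
  triangular matrices with nonzero diagonal entries (for q nonzero).\<close>

definition inv_mat :: "'a::field mat \<Rightarrow> 'a mat" where
  "inv_mat M = the (mat_inverse M)"

definition irreducible_tridiagonal :: "'a::zero mat \<Rightarrow> bool" where
  "irreducible_tridiagonal M \<longleftrightarrow>
     (\<forall>i<dim_row M. \<forall>j<dim_col M.
        ((i > j + 1 \<or> j > i + 1) \<longrightarrow> M $$ (i,j) = 0) \<and>
        ((i = j + 1 \<or> j = i + 1) \<longrightarrow> M $$ (i,j) \<noteq> 0))"

definition lower_split_mat :: "nat \<Rightarrow> (nat \<Rightarrow> 'a::field) \<Rightarrow> 'a mat" where
  "lower_split_mat d \<theta> = mat (d+1) (d+1) (\<lambda>(i,j).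
     if i = j then \<theta> i else if i = j + 1 then 1 else 0)"

definition upper_split_mat :: "nat \<Rightarrow> (nat \<Rightarrow> 'a::field) \<Rightarrow> (nat \<Rightarrow> 'a) \<Rightarrow> 'a mat" where
  "upper_split_mat d \<theta> \<phi> = mat (d+1) (d+1) (\<lambda>(i,j).
     if i = j then \<theta> i else if j = i + 1 then \<phi> j else 0)"

definition A_tridiag :: "'a::field \<Rightarrow> 'a \<Rightarrow> 'a \<Rightarrow> nat \<Rightarrow> 'a mat" where
  "A_tridiag q a c d = mat (d+1) (d+1) (\<lambda>(i,j).
     if i = j then (a + inverse a) * q powi (int d - 2 * int i)
     else if i = j + 1 then inverse c * (1 - q powi (- 2 * int i))
     else if j = i + 1 then c * (1 - q powi (2 * int d - 2 * int j + 2))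
     else 0)"

definition B_tridiag :: "'a::field \<Rightarrow> 'a \<Rightarrow> nat \<Rightarrow> 'a mat" where
  "B_tridiag q b d = mat (d+1) (d+1) (\<lambda>(i,j).
     if i = j then (b + inverse b) * q powi (2 * int i - int d)
     else if i = j + 1 then q powi (- int d - 1) * (1 - q powi (2 * int i))
     else if j = i + 1 then q powi (int d + 1) * (1 - q powi (2 * int j - 2 * int d - 2))
     else 0)"

section \<open>Feasible sequences and parameter arrays of q-Racah type\<close>

definition feasible :: "'a::field \<Rightarrow> 'a \<Rightarrow> 'a \<Rightarrow> 'a \<Rightarrow> nat \<Rightarrow> bool" where
  "feasible q a b c d \<longleftrightarrow>
     a \<noteq> 0 \<and> b \<noteq> 0 \<and> c \<noteq> 0 \<and> d \<ge> 1 \<and>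
     {a\<^sup>2, b\<^sup>2} \<inter> {q powi (2 * k) | k. 1 - int d \<le> k \<and> k \<le> int d - 1} = {} \<and>
     {a * b * c, inverse a * b * c, a * inverse b * c, a * b * inverse c} \<inter>
       {q powi (int d - 2 * int n + 1) | n. 1 \<le> n \<and> n \<le> d} = {}"

definition theta :: "'a::field \<Rightarrow> 'a \<Rightarrow> nat \<Rightarrow> nat \<Rightarrow> 'a" where
  "theta q a d n = a * q powi (2 * int n - int d) + inverse a * q powi (int d - 2 * int n)"

definition varphi_seq :: "'a::field \<Rightarrow> 'a \<Rightarrow> 'a \<Rightarrow> 'a \<Rightarrow> nat \<Rightarrow> nat \<Rightarrow> 'a" where
  "varphi_seq q a b c d n =
     inverse a * inverse b * q powi (int d + 1) *
     (q powi (int n) - q powi (- int n)) *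
     (q powi (int n - int d - 1) - q powi (int d - int n + 1)) *
     (q powi (- int n) - a * b * c * q powi (int n - int d - 1)) *
     (q powi (- int n) - a * b * inverse c * q powi (int n - int d - 1))"

definition phi_seq :: "'a::field \<Rightarrow> 'a \<Rightarrow> 'a \<Rightarrow> 'a \<Rightarrow> nat \<Rightarrow> nat \<Rightarrow> 'a" where
  "phi_seq q a b c d n =
     a * inverse b * q powi (int d + 1) *
     (q powi (int n) - q powi (- int n)) *
     (q powi (int n - int d - 1) - q powi (int d - int n + 1)) *
     (q powi (- int n) - inverse a * b * c * q powi (int n - int d - 1)) *
     (q powi (- int n) - inverse a * b * inverse c * q powi (int n - int d - 1))"

section \<open>Linear algebra on an abstract vector space\<close>

definition endo ::
    "('a::field \<Rightarrow> 'b::ab_group_add \<Rightarrow> 'b) \<Rightarrow>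
     ('b \<Rightarrow> 'b) \<Rightarrow> bool" where
  "endo scale f \<longleftrightarrow> Vector_Spaces.linear scale scale f"

text \<open>\<open>v 0, ..., v d\<close> is a basis of the whole space; values of \<open>v\<close> beyond \<open>d\<close> are irrelevant.\<close>

definition is_basis ::
    "('a::field \<Rightarrow> 'b::ab_group_add \<Rightarrow> 'b) \<Rightarrow>
     nat \<Rightarrow> (nat \<Rightarrow> 'b) \<Rightarrow> bool" where
  "is_basis scale d v \<longleftrightarrow> inj_on v {..d} \<and>
     \<not> module.dependent scale (v ` {..d}) \<and> module.span scale (v ` {..d}) = UNIV"

definition represents ::
    "('a::field \<Rightarrow> 'b::ab_group_add \<Rightarrow> 'b) \<Rightarrow>
     nat \<Rightarrow> (nat \<Rightarrow> 'b) \<Rightarrow> 'a mat \<Rightarrow> ('b \<Rightarrow> 'b) \<Rightarrow> bool" where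
  "represents scale d v M f \<longleftrightarrow>
     M \<in> carrier_mat (d+1) (d+1) \<and> (\<forall>n\<le>d. f (v n) = (\<Sum>i\<le>d. scale (M $$ (i,n)) (v i)))"

definition eigenspace ::
    "('a::field \<Rightarrow> 'b::ab_group_add \<Rightarrow> 'b) \<Rightarrow>
     ('b \<Rightarrow> 'b) \<Rightarrow> 'a \<Rightarrow> 'b set" where
  "eigenspace scale f e = {v. f v = scale e v}"

definition diagonalizable ::
    "('a::field \<Rightarrow> 'b::ab_group_add \<Rightarrow> 'b) \<Rightarrow>
     ('b \<Rightarrow> 'b) \<Rightarrow> bool" where
  "diagonalizable scale f \<longleftrightarrow> module.span scale (\<Union>e. eigenspace scale f e) = UNIV"

section \<open>Leonard pairs\<close>

definition Leonard_pair ::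
    "('a::field \<Rightarrow> 'b::ab_group_add \<Rightarrow> 'b) \<Rightarrow>
     ('b \<Rightarrow> 'b) \<Rightarrow> ('b \<Rightarrow> 'b) \<Rightarrow> bool" where
  "Leonard_pair scale A B \<longleftrightarrow> endo scale A \<and> endo scale B \<and>
     (\<exists>d v M N. is_basis scale d v \<and> represents scale d v M A \<and> represents scale d v N B \<and>
        diagonal_mat M \<and> irreducible_tridiagonal N) \<and>
     (\<exists>d v M N. is_basis scale d v \<and> represents scale d v M A \<and> represents scale d v N B \<and>
        irreducible_tridiagonal M \<and> diagonal_mat N)"

text \<open>\<open>A, B\<close> corresponds to \<open>(a, b, c, d)\<close>. The two bases determine the pair up to isomorphism,
  and any isomorphic pair has such bases.\<close>

definition q_Racah_Leonard_pair ::
    "('a::field \<Rightarrow> 'b::ab_group_add \<Rightarrow> 'b) \<Rightarrow>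
     'a \<Rightarrow> 'a \<Rightarrow> 'a \<Rightarrow> 'a \<Rightarrow> nat \<Rightarrow> ('b \<Rightarrow> 'b) \<Rightarrow> ('b \<Rightarrow> 'b) \<Rightarrow> bool" where
  "q_Racah_Leonard_pair scale q a b c d A B \<longleftrightarrow>
     feasible q a b c d \<and> Leonard_pair scale A B \<and>
     (\<exists>v. is_basis scale d v \<and>
        represents scale d v (lower_split_mat d (theta q a d)) A \<and>
        represents scale d v (upper_split_mat d (theta q b d) (varphi_seq q a b c d)) B) \<and>
     (\<exists>v. is_basis scale d v \<and>
        represents scale d v (lower_split_mat d (\<lambda>n. theta q a d (d - n))) A \<and>
        represents scale d v (upper_split_mat d (theta q b d) (phi_seq q a b c d)) B)"

section \<open>Modules for the q-tetrahedron algebra\<close>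

text \<open>The type \<open>4\<close> is the ring of integers modulo 4. A module for the algebra presented by the
  standard generators and relations is given by the family \<open>x\<close> of operators by which the
  standard generators act; \<open>x i j\<close> is irrelevant unless \<open>std_gen i j\<close>.\<close>

definition std_gen :: "4 \<Rightarrow> 4 \<Rightarrow> bool" where
  "std_gen i j \<longleftrightarrow> j - i = 1 \<or> j - i = 2"

definition q_int :: "'a::field \<Rightarrow> nat \<Rightarrow> 'a" where
  "q_int q n = (q powi (int n) - q powi (- int n)) / (q - inverse q)"

definition boxq_module ::
    "('a::field \<Rightarrow> 'b::ab_group_add \<Rightarrow> 'b) \<Rightarrow>
     'a \<Rightarrow> (4 \<Rightarrow> 4 \<Rightarrow> 'b \<Rightarrow> 'b) \<Rightarrow> bool" where
  "boxq_module scale q x \<longleftrightarrow>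
     (\<forall>i j. std_gen i j \<longrightarrow> endo scale (x i j)) \<and>
     (\<forall>i j v. j - i = 2 \<longrightarrow> x i j (x j i v) = v) \<and>
     (\<forall>i j k v. (j - i, k - j) \<in> {(1,1), (1,2), (2,1)} \<longrightarrow>
        scale (inverse (q - inverse q))
          (scale q (x i j (x j k v)) - scale (inverse q) (x j k (x i j v))) = v) \<and>
     (\<forall>i j k l v. j - i = 1 \<and> k - j = 1 \<and> l - k = 1 \<longrightarrow>
        x i j (x i j (x i j (x k l v)))
        - scale (q_int q 3) (x i j (x i j (x k l (x i j v))))
        + scale (q_int q 3) (x i j (x k l (x i j (x i j v))))
        - x k l (x i j (x i j (x i j v))) = 0)"

definition irreducible_module ::
    "('a::field \<Rightarrow> 'b::ab_group_add \<Rightarrow> 'b) \<Rightarrow>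
     (4 \<Rightarrow> 4 \<Rightarrow> 'b \<Rightarrow> 'b) \<Rightarrow> bool" where
  "irreducible_module scale x \<longleftrightarrow> (UNIV :: 'b set) \<noteq> {0} \<and>
     (\<forall>W. module.subspace scale W \<and> (\<forall>i j. std_gen i j \<longrightarrow> x i j ` W \<subseteq> W)
        \<longrightarrow> W = {0} \<or> W = UNIV)"

definition trivial_module ::
    "('a::field \<Rightarrow> 'b::ab_group_add \<Rightarrow> 'b) \<Rightarrow>
     (4 \<Rightarrow> 4 \<Rightarrow> 'b \<Rightarrow> 'b) \<Rightarrow> bool" where
  "trivial_module scale x \<longleftrightarrow> vector_space.dim scale (UNIV :: 'b set) = 1 \<and>
     (\<forall>i j. std_gen i j \<longrightarrow> x i j = id)"

definition has_diameter_type ::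
    "('a::field \<Rightarrow> 'b::ab_group_add \<Rightarrow> 'b) \<Rightarrow>
     'a \<Rightarrow> (4 \<Rightarrow> 4 \<Rightarrow> 'b \<Rightarrow> 'b) \<Rightarrow> nat \<Rightarrow> 'a \<Rightarrow> bool" where
  "has_diameter_type scale q x d \<epsilon> \<longleftrightarrow> \<epsilon> \<in> {1, - 1} \<and>
     (\<forall>i j. std_gen i j \<longrightarrow> diagonalizable scale (x i j) \<and>
        {e. eigenspace scale (x i j) e \<noteq> {0}} = {\<epsilon> * q powi (int d - 2 * int n) | n. n \<le> d})"

text \<open>Component \<open>n\<close>, for \<open>n \<le> d\<close>, of the decomposition \<open>[i,j]\<close>, for \<open>i \<noteq> j\<close>, of a module of type 1
  and diameter \<open>d\<close>.\<close>

definition decomposition ::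
    "('a::field \<Rightarrow> 'b::ab_group_add \<Rightarrow> 'b) \<Rightarrow>
     'a \<Rightarrow> (4 \<Rightarrow> 4 \<Rightarrow> 'b \<Rightarrow> 'b) \<Rightarrow> nat \<Rightarrow> 4 \<Rightarrow> 4 \<Rightarrow> nat \<Rightarrow> 'b set" where
  "decomposition scale q x d i j n =
     (if std_gen i j then eigenspace scale (x i j) (q powi (int d - 2 * int n))
      else eigenspace scale (x j i) (q powi (int d - 2 * int (d - n))))"

text \<open>Component \<open>n\<close> of the flag \<open>[i]\<close>. It is the same for every decomposition \<open>[i,j]\<close> with
  \<open>j \<noteq> i\<close>; the choice made here is \<open>j = i + 1\<close>.\<close>

definition flag ::
    "('a::field \<Rightarrow> 'b::ab_group_add \<Rightarrow> 'b) \<Rightarrow>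
     'a \<Rightarrow> (4 \<Rightarrow> 4 \<Rightarrow> 'b \<Rightarrow> 'b) \<Rightarrow> nat \<Rightarrow> 4 \<Rightarrow> nat \<Rightarrow> 'b set" where
  "flag scale q x d i n = module.span scale (\<Union>m\<le>n. decomposition scale q x d i (i + 1) m)"

definition evaluation_module ::
    "('a::field \<Rightarrow> 'b::ab_group_add \<Rightarrow> 'b) \<Rightarrow>
     'a \<Rightarrow> (4 \<Rightarrow> 4 \<Rightarrow> 'b \<Rightarrow> 'b) \<Rightarrow> nat \<Rightarrow> bool" where
  "evaluation_module scale q x d \<longleftrightarrow>
     boxq_module scale q x \<and> (\<exists>S. finite S \<and> module.span scale S = (UNIV :: 'b set)) \<and>
     irreducible_module scale x \<and> \<not> trivial_module scale x \<and>
     has_diameter_type scale q x d 1 \<and>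
     (\<forall>i j n. i \<noteq> j \<and> n \<le> d \<longrightarrow> vector_space.dim scale (decomposition scale q x d i j n) = 1)"

text \<open>The module given by \<open>x\<close> is isomorphic to the evaluation module \<open>V\<^sub>d(t)\<close>, which is defined by
  its having a basis with respect to which the standard generators are represented as below.\<close>

definition is_V ::
    "('a::field \<Rightarrow> 'b::ab_group_add \<Rightarrow> 'b) \<Rightarrow>
     'a \<Rightarrow> (4 \<Rightarrow> 4 \<Rightarrow> 'b \<Rightarrow> 'b) \<Rightarrow> nat \<Rightarrow> 'a \<Rightarrow> bool" where
  "is_V scale q x d t \<longleftrightarrow>
     (\<exists>w. is_basis scale d w \<and>
        represents scale d w (Z_mat d * S_mat d (inverse q) (inverse t) * Z_mat d) (x 0 1) \<and>
        represents scale d w (E_mat d q) (x 1 2) \<and>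
        represents scale d w (K_mat d q) (x 2 3) \<and>
        represents scale d w (Z_mat d * G_mat d (inverse q) t * Z_mat d) (x 3 0) \<and>
        represents scale d w (L_mat d q t) (x 0 2) \<and>
        represents scale d w (inv_mat (Z_mat d * E_mat d (inverse q) * Z_mat d)) (x 1 3) \<and>
        represents scale d w (inv_mat (L_mat d q t)) (x 2 0) \<and>
        represents scale d w (Z_mat d * E_mat d (inverse q) * Z_mat d) (x 3 1))"

definition evaluation_module_with_parameter ::
    "('a::field \<Rightarrow> 'b::ab_group_add \<Rightarrow> 'b) \<Rightarrow>
     'a \<Rightarrow> (4 \<Rightarrow> 4 \<Rightarrow> 'b \<Rightarrow> 'b) \<Rightarrow> nat \<Rightarrow> 'a \<Rightarrow> bool" where
  "evaluation_module_with_parameter scale q x d t \<longleftrightarrow>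
     evaluation_module scale q x d \<and>
     t \<noteq> 0 \<and> t \<notin> {q powi (int d - 2 * int n + 1) | n. 1 \<le> n \<and> n \<le> d} \<and>
     is_V scale q x d t"

definition ijkl_basis ::
    "('a::field \<Rightarrow> 'b::ab_group_add \<Rightarrow> 'b) \<Rightarrow>
     'a \<Rightarrow> (4 \<Rightarrow> 4 \<Rightarrow> 'b \<Rightarrow> 'b) \<Rightarrow> nat \<Rightarrow> 4 \<Rightarrow> 4 \<Rightarrow> 4 \<Rightarrow> 4 \<Rightarrow> (nat \<Rightarrow> 'b) \<Rightarrow> bool" where
  "ijkl_basis scale q x d i j k l u \<longleftrightarrow>
     distinct [i, j, k, l] \<and> is_basis scale d u \<and>
     (\<forall>n\<le>d. u n \<in> decomposition scale q x d k l n) \<and>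
     (\<Sum>n\<le>d. u n) \<in> flag scale q x d j 0"

end

theory Submission
  imports Defs
begin

text \<open>
  Let \<open>u 0, \<dots>, u d\<close> be eigenvectors of \<open>x 0 2\<close> for the eigenvalues
  \<open>q powi d, q powi (d-2), \<dots>, q powi (-d)\<close>.
  The operators \<open>x 3 0\<close>, \<open>x 0 2\<close>, \<open>x 2 3\<close> satisfy the \<open>q\<close>-Weyl relation cyclically, that is, they form an equitable
  triple for the quantum group of \<open>sl\<^sub>2\<close>; so do \<open>x 0 1\<close>, \<open>x 2 0\<close>, \<open>x 1 2\<close> once \<open>q\<close> is replaced by its
  inverse. The \<open>q\<close>-Weyl relation with \<open>x 0 2\<close> or with its inverse \<open>x 2 0\<close> makes every one of the other
  four operators bidiagonal on the \<open>u n\<close>, with known diagonal: \<open>x 3 0\<close> and \<open>x 0 1\<close> lower the index (with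
  coefficients \<open>e n\<close> and \<open>g n\<close>, say), \<open>x 2 3\<close> and \<open>x 1 2\<close> raise it (with coefficients \<open>f n\<close> and
  \<open>h n\<close>). This is why \<open>A = a x 0 1 + inverse a x 1 2\<close> and \<open>B = b x 2 3 + inverse b x 3 0\<close> are tridiagonal.

  The off-diagonal coefficients are pinned down as follows (\<open>bidiagonal_actions\<close>). The products
  \<open>e n * f n\<close> and \<open>g n * h n\<close> satisfy a recurrence read off from the diagonal of the remaining relation of
  each triple (\<open>equitable_product\<close>). The relation between \<open>x 1 2\<close> and \<open>x 2 3\<close> determines the ratios
  \<open>h n / f n\<close> up to one common factor, and that factor is the evaluation parameter
  (\<open>parameter_on_lowest_vector\<close>). What is left is the freedom to rescale each \<open>u n\<close>, and it is used up,
  except for one overall factor, by the requirement that the sum of the \<open>u n\<close> be in component 0 of the flag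
  \<open>[3]\<close>: this says that the sum is an eigenvector of \<open>x 3 0\<close>, which gives \<open>e n\<close>
  (\<open>normalized_actions\<close>). Passing to \<open>v n = (q b)^n u n\<close> yields the two matrices, so (ii) implies (i).

  For the converse, a [1,3,0,2]-basis exists because no \<open>e n\<close> vanishes, so that an eigenvector of
  \<open>x 3 0\<close> has nonzero components along all \<open>u n\<close> (\<open>ijkl_basis_exists\<close>). By the first part its rescaling
  \<open>v'\<close> gives the same two matrices as the given basis \<open>v\<close>; hence the linear map taking \<open>v'\<close> to \<open>v\<close>
  commutes with \<open>A\<close> and \<open>B\<close>. Only scalars commute with a pair in split form
  whose second member has distinct eigenvalues (\<open>split_form_centralizer\<close>), so \<open>v\<close> is a multiple of \<open>v'\<close>, and being a [1,3,0,2]-basis survives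
  multiplication by a nonzero scalar.
\<close>

section \<open>Coordinates and eigenvectors\<close>

lemma linear_maps:
  assumes "endo scale f"
  shows endo_add: "f (y + z) = f y + f z"
    and endo_diff: "f (y - z) = f y - f z"
    and endo_scale: "f (scale r y) = scale r (f y)"
    and endo_zero: "f 0 = 0"
    and endo_sum: "f (sum g S) = (\<Sum>i\<in>S. f (g i))"
proof -
  have "module_hom scale scale f"
    using assms by (simp add: endo_def Vector_Spaces.linear_def)
  then show "f (y + z) = f y + f z" "f (y - z) = f y - f z" "f (scale r y) = scale r (f y)"
    "f 0 = 0" "f (sum g S) = (\<Sum>i\<in>S. f (g i))"
    by (rule module_hom.add module_hom.diff module_hom.scale module_hom.zero module_hom.sum)+
qed

locale operator_space = vector_space scale
  for scale :: "'a::field \<Rightarrow> 'b::ab_group_add \<Rightarrow> 'b"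
begin

lemma endoI:
  assumes "\<And>y z. f (y + z) = f y + f z" "\<And>r y. f (scale r y) = scale r (f y)"
  shows "endo scale f"
proof -
  have "Modules.module scale" by unfold_locales
  then show ?thesis
    unfolding endo_def Vector_Spaces.linear_def module_hom_def module_hom_axioms_def
    using assms vector_space_axioms by blast
qed

definition coord :: "nat \<Rightarrow> (nat \<Rightarrow> 'b) \<Rightarrow> nat \<Rightarrow> 'b \<Rightarrow> 'a" where
  "coord d u n z = representation (u ` {..d}) z (u n)"

lemma coord_zero: "coord d u n 0 = 0"
  by (simp add: coord_def representation_zero)

context
  fixes d :: nat and u :: "nat \<Rightarrow> 'b"
  assumes basis: "is_basis scale d u"
begin

lemma basis_simps: "inj_on u {..d}" "independent (u ` {..d})" "z \<in> span (u ` {..d})"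
  using basis by (auto simp: is_basis_def)

lemma coord_add: "coord d u n (y + z) = coord d u n y + coord d u n z"
  by (simp add: coord_def representation_add basis_simps)

lemma coord_diff: "coord d u n (y - z) = coord d u n y - coord d u n z"
  by (simp add: coord_def representation_diff basis_simps)

lemma coord_scale: "coord d u n (scale r y) = r * coord d u n y"
  by (simp add: coord_def representation_scale basis_simps)

lemma coord_sum: "coord d u n (sum g S) = (\<Sum>i\<in>S. coord d u n (g i))"
  by (induction S rule: infinite_finite_induct) (simp_all add: coord_add coord_zero)

lemma coord_basis: "n \<le> d \<Longrightarrow> m \<le> d \<Longrightarrow> coord d u n (u m) = (if n = m then 1 else 0)"
  using basis_simps(1) by (auto simp: coord_def representation_basis basis_simps inj_on_def)

lemma coord_expansion: "(\<Sum>n\<le>d. scale (coord d u n z) (u n)) = z"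
  using sum_representation_eq[OF basis_simps(2,3), of "u ` {..d}" z]
  by (simp add: sum.reindex[OF basis_simps(1)] coord_def)

lemma basis_nonzero: "n \<le> d \<Longrightarrow> u n \<noteq> 0"
  using dependent_zero basis_simps(2) by (metis atMost_iff imageI)

lemma endo_eqI:
  assumes "endo scale f" "endo scale g" "\<And>n. n \<le> d \<Longrightarrow> f (u n) = g (u n)"
  shows "f z = g z"
proof -
  have "f (\<Sum>n\<le>d. scale (coord d u n z) (u n)) = g (\<Sum>n\<le>d. scale (coord d u n z) (u n))"
    using assms(3) by (simp add: endo_sum[OF assms(1)] endo_sum[OF assms(2)]
        endo_scale[OF assms(1)] endo_scale[OF assms(2)])
  then show ?thesis by (simp only: coord_expansion)
qed

lemma coord_of_endo:
  assumes "endo scale f"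
  shows "coord d u n (f z) = (\<Sum>m\<le>d. coord d u m z * coord d u n (f (u m)))"
proof -
  have "f z = f (\<Sum>m\<le>d. scale (coord d u m z) (u m))" by (simp only: coord_expansion)
  also have "\<dots> = (\<Sum>m\<le>d. scale (coord d u m z) (f (u m)))"
    by (simp add: endo_sum[OF assms] endo_scale[OF assms])
  finally show ?thesis by (simp add: coord_sum coord_scale)
qed

lemma eigenvector_coord_eq_0:
  assumes "endo scale Y" "\<And>n. n \<le> d \<Longrightarrow> Y (u n) = scale (\<theta> n) (u n)"
    and "Y z = scale \<mu> z" "n \<le> d" "\<theta> n \<noteq> \<mu>"
  shows "coord d u n z = 0"
proof -
  have "coord d u n (Y z) = (\<Sum>m\<le>d. if m = n then coord d u n z * \<theta> n else 0)"
    unfolding coord_of_endo[OF assms(1), of n z]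
    using assms(2,4) by (intro sum.cong) (auto simp: coord_scale coord_basis)
  also have "\<dots> = \<theta> n * coord d u n z" using assms(4) by simp
  finally have "\<mu> * coord d u n z = \<theta> n * coord d u n z"
    unfolding assms(3) by (simp only: coord_scale)
  then show ?thesis using assms(5) by simp
qed

lemma eigenvector_on_line:
  assumes "endo scale Y" "\<And>n. n \<le> d \<Longrightarrow> Y (u n) = scale (\<theta> n) (u n)"
    and "inj_on \<theta> {..d}" "Y z = scale (\<theta> n) z" "n \<le> d"
  shows "z = scale (coord d u n z) (u n)"
proof -
  have "z = (\<Sum>m\<le>d. scale (coord d u m z) (u m))" by (rule coord_expansion[symmetric])
  also have "\<dots> = (\<Sum>m\<le>d. if m = n then scale (coord d u n z) (u n) else 0)"
  proof (intro sum.cong refl)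
    fix m assume m: "m \<in> {..d}"
    show "scale (coord d u m z) (u m) = (if m = n then scale (coord d u n z) (u n) else 0)"
    proof (cases "m = n")
      case False
      then have "\<theta> m \<noteq> \<theta> n" using assms(3,5) m by (auto simp: inj_on_def)
      then have "coord d u m z = 0"
        using eigenvector_coord_eq_0[where Y = Y and \<theta> = \<theta>, OF assms(1,2,4)] m by simp
      then show ?thesis using False by simp
    qed simp
  qed
  also have "\<dots> = scale (coord d u n z) (u n)" using assms(5) by simp
  finally show ?thesis .
qed

lemma eigenvector_eq_0:
  assumes "endo scale Y" "\<And>n. n \<le> d \<Longrightarrow> Y (u n) = scale (\<theta> n) (u n)"
    and "Y z = scale \<mu> z" "\<And>n. n \<le> d \<Longrightarrow> \<theta> n \<noteq> \<mu>"
  shows "z = 0"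
proof -
  have "z = (\<Sum>m\<le>d. scale (coord d u m z) (u m))" by (rule coord_expansion[symmetric])
  also have "\<dots> = 0"
  proof (intro sum.neutral ballI)
    fix m assume "m \<in> {..d}"
    then have "m \<le> d" by simp
    then have "coord d u m z = 0"
      by (intro eigenvector_coord_eq_0[where Y = Y and \<theta> = \<theta>, OF assms(1,2,3)] assms(4))
    then show "scale (coord d u m z) (u m) = 0" by simp
  qed
  finally show ?thesis .
qed

end

lemma is_basisI:
  assumes indep: "\<And>\<alpha> n. (\<Sum>i\<le>d. scale (\<alpha> i) (u i)) = 0 \<Longrightarrow> n \<le> d \<Longrightarrow> \<alpha> n = 0"
    and span: "span (u ` {..d}) = UNIV"
  shows "is_basis scale d u"
proof -
  have inj: "inj_on u {..d}"
  proof (rule inj_onI, rule ccontr)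
    fix i j assume ij: "i \<in> {..d}" "j \<in> {..d}" "u i = u j" "i \<noteq> j"
    let ?\<alpha> = "\<lambda>k. (if k = i then 1 else 0) - (if k = j then 1 else 0)"
    have *: "scale (if k = m then 1 else 0) (u k) = (if k = m then u m else 0)" for k m
      by simp
    have "(\<Sum>k\<le>d. scale (?\<alpha> k) (u k)) = 0"
      unfolding scale_left_diff_distrib * using ij by (simp add: sum_subtractf)
    from indep[OF this, of i] ij show False by simp
  qed
  have "independent (u ` {..d})"
  proof
    assume "dependent (u ` {..d})"
    then obtain g where g: "\<exists>y\<in>u ` {..d}. g y \<noteq> 0" "(\<Sum>y\<in>u ` {..d}. scale (g y) y) = 0"
      by (auto simp: dependent_finite)
    have "(\<Sum>i\<le>d. scale (g (u i)) (u i)) = 0"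
      using g(2) by (simp add: sum.reindex[OF inj])
    with g(1) indep[of "\<lambda>i. g (u i)"] show False by auto
  qed
  with inj span show ?thesis by (simp add: is_basis_def)
qed

lemma is_basis_rescale:
  assumes "is_basis scale d u" "\<And>n. n \<le> d \<Longrightarrow> r n \<noteq> 0"
  shows "is_basis scale d (\<lambda>n. scale (r n) (u n))"
proof (rule is_basisI)
  fix \<alpha> n assume *: "(\<Sum>i\<le>d. scale (\<alpha> i) (scale (r i) (u i))) = 0" "n \<le> d"
  have "coord d u n (\<Sum>i\<le>d. scale (\<alpha> i) (scale (r i) (u i)))
      = (\<Sum>i\<le>d. if i = n then \<alpha> n * r n else 0)"
    unfolding coord_sum[OF assms(1)]
    using *(2) by (intro sum.cong) (auto simp: coord_scale coord_basis assms(1))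
  then show "\<alpha> n = 0" using * assms(2) by (simp add: coord_zero)
next
  let ?S = "(\<lambda>n. scale (r n) (u n)) ` {..d}"
  have "u n \<in> span ?S" if "n \<le> d" for n
  proof -
    have "scale (inverse (r n)) (scale (r n) (u n)) \<in> span ?S"
      using that by (intro span_scale span_base imageI) simp
    then show ?thesis using assms(2)[OF that] by simp
  qed
  then have "span (u ` {..d}) \<subseteq> span ?S" by (intro span_minimal) auto
  then show "span ?S = UNIV" using assms(1) by (auto simp: is_basis_def)
qed

text \<open>The usual proof that eigenvectors for distinct eigenvalues are independent: applying
  \<open>Y - \<theta> (Suc d)\<close> to a linear relation removes its last term and rescales the others by nonzero factors.\<close>

lemma eigenvectors_independent:
  fixes d n :: nat
  assumes "endo scale Y" "\<And>n. n \<le> d \<Longrightarrow> Y (u n) = scale (\<theta> n) (u n)"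
    and "inj_on \<theta> {..d}" "\<And>n. n \<le> d \<Longrightarrow> u n \<noteq> 0"
    and "(\<Sum>i\<le>d. scale (\<alpha> i) (u i)) = 0" "n \<le> d"
  shows "\<alpha> n = 0"
  using assms(2-)
proof (induction d arbitrary: \<alpha> n)
  case 0
  then show ?case by simp
next
  case (Suc d)
  let ?s = "\<Sum>i\<le>Suc d. scale (\<alpha> i) (u i)"
  have "Y ?s - scale (\<theta> (Suc d)) ?s = (\<Sum>i\<le>Suc d. scale (\<alpha> i * (\<theta> i - \<theta> (Suc d))) (u i))"
    using Suc.prems(1)
    by (simp add: endo_sum[OF assms(1)] endo_add[OF assms(1)] endo_scale[OF assms(1)]
        scale_sum_right scale_right_distrib scale_left_diff_distrib sum_subtractf algebra_simps)
  then have eq: "(\<Sum>i\<le>d. scale (\<alpha> i * (\<theta> i - \<theta> (Suc d))) (u i)) = 0"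
    using Suc.prems(4) by (simp add: endo_zero[OF assms(1)])
  have low: "\<alpha> m = 0" if "m \<le> d" for m
  proof -
    have "\<alpha> m * (\<theta> m - \<theta> (Suc d)) = 0"
      using Suc.IH[OF _ _ _ eq that] Suc.prems(1-3) by (simp add: inj_on_def)
    moreover have "\<theta> m \<noteq> \<theta> (Suc d)"
      using inj_onD[OF Suc.prems(2), of m "Suc d"] that by auto
    ultimately show ?thesis by simp
  qed
  have "scale (\<alpha> (Suc d)) (u (Suc d)) = 0"
    using Suc.prems(4) low by simp
  then have "\<alpha> (Suc d) = 0" using Suc.prems(3)[of "Suc d"] by simp
  with low Suc.prems(5) show ?case by (auto simp: le_Suc_eq)
qed

end

section \<open>Equitable triples\<close>

lemma power_int_eq_iff_of_non_root:
  fixes q :: "'a::field"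
  assumes "q \<noteq> 0" "\<And>n::nat. n > 0 \<Longrightarrow> q ^ n \<noteq> 1"
  shows "q powi k = q powi l \<longleftrightarrow> k = l"
proof
  have trivial: "m = 0" if "q powi m = 1" for m
  proof (rule ccontr)
    assume m: "m \<noteq> 0"
    have "q ^ nat \<bar>m\<bar> = 1"
    proof (cases "m \<ge> 0")
      case True
      then show ?thesis using that by (simp add: power_int_def)
    next
      case False
      then show ?thesis using that by (simp add: power_int_def power_inverse)
    qed
    then show False using assms(2)[of "nat \<bar>m\<bar>"] m by simp
  qed
  assume "q powi k = q powi l"
  then have "q powi (k - l) = 1" using assms(1) by (simp add: power_int_diff)
  then show "k = l" using trivial by force
qed simp

text \<open>The relation \<open>(q X Y - inverse q Y X) / (q - inverse q) = 1\<close> with the denominator cleared.\<close>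

definition q_weyl :: "('a::field \<Rightarrow> 'b::ab_group_add \<Rightarrow> 'b) \<Rightarrow> 'a \<Rightarrow> ('b \<Rightarrow> 'b) \<Rightarrow> ('b \<Rightarrow> 'b) \<Rightarrow> bool" where
  "q_weyl scale q X Y \<longleftrightarrow>
     (\<forall>z. scale q (X (Y z)) - scale (inverse q) (Y (X z)) = scale (q - inverse q) z)"

context operator_space
begin

text \<open>Swapping \<open>X\<close> and \<open>Y\<close> amounts to inverting \<open>q\<close>. Statements about one equitable triple
  therefore apply to both of those in the module, and the same computation covers operators that
  raise and operators that lower the eigenvalue index.\<close>

lemma q_weyl_inverse:
  assumes "q_weyl scale q X Y"
  shows "q_weyl scale (inverse q) Y X"
proof -
  have "scale (inverse q) (Y (X z)) - scale q (X (Y z)) = - scale (q - inverse q) z" for z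
    using assms by (metis q_weyl_def minus_diff_eq)
  then show ?thesis by (simp add: q_weyl_def flip: scale_minus_left)
qed

text \<open>On an eigenvector \<open>w\<close> of \<open>Y\<close> the relation is an inhomogeneous linear equation for \<open>X w\<close>, namely
  \<open>Y (X w) = q\<^sup>2 \<theta> (X w) - (q\<^sup>2 - 1) w\<close>. A particular solution is \<open>inverse \<theta> * w\<close>, and the difference
  from it solves the homogeneous equation.\<close>

lemma q_weyl_eigenvector_shift:
  assumes weyl: "q_weyl scale q X Y" and X: "endo scale X" and Y: "endo scale Y"
    and q: "q \<noteq> 0" "\<theta> \<noteq> 0" and w: "Y w = scale \<theta> w"
  shows "Y (X w - scale (inverse \<theta>) w) = scale (q\<^sup>2 * \<theta>) (X w - scale (inverse \<theta>) w)"
proof -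
  have "scale (q * \<theta>) (X w) - scale (inverse q) (Y (X w)) = scale (q - inverse q) w"
    using weyl[unfolded q_weyl_def, rule_format, of w] w by (simp add: endo_scale[OF X])
  then have "scale (inverse q) (Y (X w)) = scale (q * \<theta>) (X w) - scale (q - inverse q) w"
    by (metis diff_diff_eq2 add_diff_cancel_left' diff_add_cancel)
  then have "scale q (scale (inverse q) (Y (X w)))
      = scale q (scale (q * \<theta>) (X w) - scale (q - inverse q) w)"
    by (rule arg_cong)
  also have "\<dots> = scale (q\<^sup>2 * \<theta>) (X w) - scale (q\<^sup>2 - 1) w"
    using q by (simp add: scale_right_diff_distrib power2_eq_square right_diff_distrib mult.assoc)
  finally have "Y (X w) = scale (q\<^sup>2 * \<theta>) (X w) - scale (q\<^sup>2 - 1) w"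
    using q by simp
  then show ?thesis
    using q by (simp add: endo_diff[OF Y] endo_scale[OF Y] w scale_right_diff_distrib
        scale_left_diff_distrib)
qed

text \<open>The shifted eigenvalue \<open>q\<^sup>2 \<theta>\<close> is the one of \<open>u (n - 1)\<close>, and for \<open>n = 0\<close> it is not an eigenvalue
  of \<open>Y\<close> because \<open>q\<close> is not a root of unity.\<close>

lemma q_weyl_lowering:
  assumes basis: "is_basis scale d u"
    and q: "q \<noteq> 0" "\<And>n::nat. n > 0 \<Longrightarrow> q ^ n \<noteq> 1"
    and weyl: "q_weyl scale q X Y" and X: "endo scale X" and Y: "endo scale Y"
    and eig: "\<And>n. n \<le> d \<Longrightarrow> Y (u n) = scale (q powi (int d - 2 * int n)) (u n)"
  shows "\<exists>e. \<forall>n\<le>d. X (u n) = scale (q powi (2 * int n - int d)) (u n)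
           + (if n = 0 then 0 else scale (e n) (u (n - 1)))"
proof -
  note q_inj = power_int_eq_iff_of_non_root[OF q]
  let ?\<theta> = "\<lambda>n. q powi (int d - 2 * int n)"
  let ?z = "\<lambda>n. X (u n) - scale (q powi (2 * int n - int d)) (u n)"
  have z: "Y (?z n) = scale (q powi (int d - 2 * (int n - 1))) (?z n)" if "n \<le> d" for n
  proof -
    have "inverse (?\<theta> n) = q powi (2 * int n - int d)"
      by (simp flip: power_int_minus)
    moreover have "q\<^sup>2 * ?\<theta> n = q powi (int d - 2 * (int n - 1))"
      using q(1) by (simp add: power_int_diff power_int_add power_int_mult algebra_simps)
    ultimately show ?thesis
      using q_weyl_eigenvector_shift[OF weyl X Y q(1) _ eig[OF that]] q(1) by simp
  qed
  have inj: "inj_on ?\<theta> {..d}" by (auto simp: inj_on_def q_inj)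
  have "X (u n) = scale (q powi (2 * int n - int d)) (u n)
      + (if n = 0 then 0 else scale (coord d u (n - 1) (?z n)) (u (n - 1)))" if n: "n \<le> d" for n
  proof (cases "n = 0")
    case True
    have "?z n = 0"
      using eigenvector_eq_0[OF basis Y eig z[OF n]] True by (simp add: q_inj)
    then show ?thesis using True by simp
  next
    case False
    then have *: "Y (?z n) = scale (?\<theta> (n - 1)) (?z n)" "n - 1 \<le> d"
      using z[OF n] n by (simp_all add: of_nat_diff)
    have "?z n = scale (coord d u (n - 1) (?z n)) (u (n - 1))"
      by (rule eigenvector_on_line[OF basis Y eig inj *])
    then have "X (u n) = scale (coord d u (n - 1) (?z n)) (u (n - 1))
        + scale (q powi (2 * int n - int d)) (u n)"
      by (simp only: diff_eq_eq)
    then show ?thesis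
      unfolding if_not_P[OF False] by (rule trans[OF _ add.commute])
  qed
  then show ?thesis
    by (intro exI[of _ "\<lambda>n. coord d u (n - 1) (?z n)"] allI impI)
qed

lemma q_weyl_raising:
  assumes basis: "is_basis scale d u"
    and q: "q \<noteq> 0" "\<And>n::nat. n > 0 \<Longrightarrow> q ^ n \<noteq> 1"
    and weyl: "q_weyl scale q Y X" and X: "endo scale X" and Y: "endo scale Y"
    and eig: "\<And>n. n \<le> d \<Longrightarrow> Y (u n) = scale (q powi (int d - 2 * int n)) (u n)"
  shows "\<exists>f. \<forall>n\<le>d. X (u n) = scale (q powi (2 * int n - int d)) (u n)
           + (if n = d then 0 else scale (f (Suc n)) (u (Suc n)))"
proof -
  note q_inj = power_int_eq_iff_of_non_root[OF q]
  let ?\<theta> = "\<lambda>n. q powi (int d - 2 * int n)"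
  let ?z = "\<lambda>n. X (u n) - scale (q powi (2 * int n - int d)) (u n)"
  have z: "Y (?z n) = scale (?\<theta> (Suc n)) (?z n)" if "n \<le> d" for n
  proof -
    have "inverse (?\<theta> n) = q powi (2 * int n - int d)"
      by (simp flip: power_int_minus)
    moreover have "(inverse q)\<^sup>2 * ?\<theta> n = ?\<theta> (Suc n)"
      using q(1) by (simp add: power_int_diff power_int_mult power_int_add field_simps power2_eq_square)
    ultimately show ?thesis
      using q_weyl_eigenvector_shift[OF q_weyl_inverse[OF weyl] X Y _ _ eig[OF that]] q(1) by simp
  qed
  have inj: "inj_on ?\<theta> {..d}" by (auto simp: inj_on_def q_inj)
  have "X (u n) = scale (q powi (2 * int n - int d)) (u n)
      + (if n = d then 0 else scale (coord d u (Suc n) (?z (Suc n - 1))) (u (Suc n)))" if n: "n \<le> d" for n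
  proof (cases "n = d")
    case True
    have "?z n = 0"
      using eigenvector_eq_0[OF basis Y eig z[OF n]] True by (simp add: q_inj)
    then show ?thesis using True by simp
  next
    case False
    then have *: "Y (?z n) = scale (?\<theta> (Suc n)) (?z n)" "Suc n \<le> d"
      using z[OF n] n by simp_all
    have "?z n = scale (coord d u (Suc n) (?z n)) (u (Suc n))"
      by (rule eigenvector_on_line[OF basis Y eig inj *])
    then have "X (u n) = scale (coord d u (Suc n) (?z n)) (u (Suc n))
        + scale (q powi (2 * int n - int d)) (u n)"
      by (simp only: diff_eq_eq)
    then show ?thesis
      unfolding diff_Suc_1 if_not_P[OF False] by (rule trans[OF _ add.commute])
  qed
  then show ?thesis
    by (intro exI[of _ "\<lambda>m. coord d u m (?z (m - 1))"] allI impI)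
qed

text \<open>Comparing the coefficients of \<open>u n\<close> in \<open>q F R - inverse q R F = q - inverse q\<close> gives a first-order
  recurrence for the products \<open>e n * f n\<close>, which starts from 0 at \<open>n = 0\<close> since \<open>R\<close> does not lower
  \<open>u 0\<close> any further. The right-hand side is its solution; it vanishes at \<open>n = d + 1\<close>, in accordance
  with \<open>F\<close> not raising \<open>u d\<close>.\<close>

lemma equitable_product:
  assumes basis: "is_basis scale d u" and q: "q \<noteq> 0"
    and weyl: "q_weyl scale q F R" and F: "endo scale F" and R: "endo scale R"
    and Ru: "\<And>n. n \<le> d \<Longrightarrow> R (u n) = scale (q powi (2 * int n - int d)) (u n)
           + (if n = 0 then 0 else scale (e n) (u (n - 1)))"
    and Fu: "\<And>n. n \<le> d \<Longrightarrow> F (u n) = scale (q powi (2 * int n - int d)) (u n)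
           + (if n = d then 0 else scale (f (Suc n)) (u (Suc n)))"
    and n: "1 \<le> n" "n \<le> d"
  shows "e n * f n = (1 - q powi (2 * int n)) * (1 - q powi (2 * int n - 2 * int d - 2))"
proof -
  \<comment> \<open>The cut-offs absorb the missing terms at the two ends of the chain \<open>u 0, \<dots>, u d\<close>.\<close>
  define p where "p n = (if n = 0 \<or> n > d then 0 else e n * f n)" for n
  let ?c = "coord d u"
  note lin = coord_add coord_scale coord_zero coord_basis
    endo_add[OF F] endo_scale[OF F] endo_zero[OF F] endo_add[OF R] endo_scale[OF R] endo_zero[OF R]
  have step: "p (Suc n) = q\<^sup>2 * p n - (q\<^sup>2 - 1) * (1 - (q powi (2 * int n - int d))\<^sup>2)"
    if n: "n \<le> d" for n
  proof -
    let ?\<rho> = "q powi (2 * int n - int d)"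
    have FR: "?c n (F (R (u n))) = ?\<rho>\<^sup>2 + p n"
      using n basis by (auto simp: Ru Fu lin p_def power2_eq_square)
    have RF: "?c n (R (F (u n))) = ?\<rho>\<^sup>2 + p (Suc n)"
      using n basis by (auto simp: Ru Fu lin p_def power2_eq_square)
    have "?c n (scale q (F (R (u n))) - scale (inverse q) (R (F (u n)))) = ?c n (scale (q - inverse q) (u n))"
      using weyl by (simp add: q_weyl_def)
    then have diagonal: "q * (?\<rho>\<^sup>2 + p n) - inverse q * (?\<rho>\<^sup>2 + p (Suc n)) = q - inverse q"
      using n by (simp add: coord_diff[OF basis] coord_scale[OF basis] coord_basis[OF basis] FR RF)
    have "y = x - w" if "x - y = w" for x y w :: 'a
      using that by auto
    from this[OF diagonal]
    have eq: "inverse q * (?\<rho>\<^sup>2 + p (Suc n)) = q * (?\<rho>\<^sup>2 + p n) - (q - inverse q)" .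
    have "?\<rho>\<^sup>2 + p (Suc n) = q * (inverse q * (?\<rho>\<^sup>2 + p (Suc n)))"
      using q by simp
    also have "\<dots> = q\<^sup>2 * (?\<rho>\<^sup>2 + p n) - (q\<^sup>2 - 1)"
      unfolding eq using q by (simp add: right_diff_distrib power2_eq_square mult.assoc)
    finally show ?thesis by (simp add: algebra_simps)
  qed
  have "p n = (1 - q powi (2 * int n)) * (1 - q powi (2 * int n - 2 * int d - 2))" if "n \<le> d" for n
    using that
  proof (induction n)
    case 0
    then show ?case by (simp add: p_def)
  next
    case (Suc n)
    have e1: "(q powi (2 * int n - int d))\<^sup>2 = q powi (2 * int n) * q powi (2 * int n - 2 * int d - 2) * q\<^sup>2"
    proof -
      have "(q powi (2 * int n - int d))\<^sup>2
          = q powi (2 * int n + (2 * int n - 2 * int d - 2) + 2)"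
        by (simp add: power_int_power' algebra_simps)
      also have "\<dots> = q powi (2 * int n) * q powi (2 * int n - 2 * int d - 2) * q\<^sup>2"
        by (simp only: power_int_add[OF disjI1[OF q]] power_int_numeral)
      finally show ?thesis .
    qed
    have "2 * int (Suc n) = 2 + 2 * int n"
      and "2 * int (Suc n) - 2 * int d - 2 = 2 + (2 * int n - 2 * int d - 2)" by simp_all
    then have e2: "q powi (2 * int (Suc n)) = q\<^sup>2 * q powi (2 * int n)"
      and e3: "q powi (2 * int (Suc n) - 2 * int d - 2) = q\<^sup>2 * q powi (2 * int n - 2 * int d - 2)"
      by (simp_all only: power_int_add[OF disjI1[OF q]] power_int_numeral)
    have recurrence: "q\<^sup>2 * ((1 - x) * (1 - y)) - (q\<^sup>2 - 1) * (1 - x * y * q\<^sup>2)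
        = (1 - q\<^sup>2 * x) * (1 - q\<^sup>2 * y)" for x y
      by (simp add: algebra_simps)
    show ?case
      unfolding step[OF Suc_leD[OF Suc.prems]] Suc.IH[OF Suc_leD[OF Suc.prems]] e1 e2 e3
      by (rule recurrence)
  qed
  from this[OF n(2)] n show ?thesis by (simp add: p_def)
qed


lemma coord_lowering:
  assumes basis: "is_basis scale d u" and X: "endo scale X"
    and Xu: "\<And>n. n \<le> d \<Longrightarrow> X (u n) = scale (\<rho> n) (u n) + (if n = 0 then 0 else scale (e n) (u (n - 1)))"
    and n: "n \<le> d"
  shows "coord d u n (X z) = \<rho> n * coord d u n z
    + (if n = d then 0 else e (Suc n) * coord d u (Suc n) z)"
proof -
  have "coord d u n (X z)
      = (\<Sum>m\<le>d. (if m = n then \<rho> n * coord d u n z else 0)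
              + (if m = Suc n then e (Suc n) * coord d u (Suc n) z else 0))"
    unfolding coord_of_endo[OF basis X, of n z]
    using n by (intro sum.cong refl)
      (auto simp: Xu coord_add[OF basis] coord_scale[OF basis] coord_basis[OF basis] coord_zero)
  also have "\<dots> = \<rho> n * coord d u n z + (if n = d then 0 else e (Suc n) * coord d u (Suc n) z)"
    using n by (auto simp: sum.distrib)
  finally show ?thesis .
qed

lemma subspace_eigenspace:
  assumes "endo scale f"
  shows "subspace (eigenspace scale f r)"
  by (auto simp: subspace_def eigenspace_def endo_zero[OF assms] endo_add[OF assms]
      endo_scale[OF assms] scale_right_distrib scale_left_commute)

lemma subset_span_of_dim_1:
  assumes "dim S = 1" "z \<in> S" "z \<noteq> 0"
  shows "S \<subseteq> span {z}"
proof -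
  obtain B where B: "B \<subseteq> S" "S \<subseteq> span B" "card B = 1"
    using basis_exists[of S] assms(1) by metis
  then obtain b where b: "B = {b}" by (auto simp: card_1_singleton_iff)
  then obtain k where k: "z = scale k b" using B assms(2) by (auto simp: span_singleton)
  then have "b = scale (inverse k) z" using assms(3) by auto
  then have "b \<in> span {z}" by (metis span_base span_scale singletonI)
  then have "span B \<subseteq> span {z}" using b by (intro span_minimal) auto
  with B show ?thesis by blast
qed

end

section \<open>The eigenbasis of an evaluation module\<close>

locale evaluation_module_space = operator_space scale
  for scale :: "'a::field \<Rightarrow> 'b::ab_group_add \<Rightarrow> 'b" +
  fixes q t :: 'a and d :: nat and x :: "4 \<Rightarrow> 4 \<Rightarrow> 'b \<Rightarrow> 'b"
  assumes q_nonzero: "q \<noteq> 0" and q_not_root: "\<And>n::nat. n > 0 \<Longrightarrow> q ^ n \<noteq> 1"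
    and d_pos: "d \<ge> 1"
    and module: "evaluation_module_with_parameter scale q x d t"
begin

lemmas q_powi_eq_iff = power_int_eq_iff_of_non_root[OF q_nonzero q_not_root]

lemma q_powi_eq_1_iff: "q powi k = 1 \<longleftrightarrow> k = 0"
  using q_powi_eq_iff[of k 0] by simp

lemma inverse_q_not_root: "n > 0 \<Longrightarrow> inverse q ^ n \<noteq> 1" for n :: nat
  using q_not_root by (simp add: power_inverse)

lemma boxq: "boxq_module scale q x"
  using module by (simp add: evaluation_module_with_parameter_def evaluation_module_def)

lemma endo_generators:
  "endo scale (x 3 0)" "endo scale (x 0 2)" "endo scale (x 2 3)"
  "endo scale (x 0 1)" "endo scale (x 2 0)" "endo scale (x 1 2)"
  using boxq by (simp_all add: boxq_module_def std_gen_def)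

lemma q_weyl_generators:
  assumes "(j - i, k - j) \<in> {(1,1), (1,2), (2,1)}"
  shows "q_weyl scale q (x i j) (x j k)"
proof -
  have ne: "q - inverse q \<noteq> 0"
    using q_not_root[of 2] q_nonzero by (auto simp: power2_eq_square field_simps)
  have "scale (inverse (q - inverse q))
      (scale q (x i j (x j k z)) - scale (inverse q) (x j k (x i j z))) = z" for z
    using boxq assms unfolding boxq_module_def by blast
  then have "scale (q - inverse q) z = scale (q - inverse q) (scale (inverse (q - inverse q))
      (scale q (x i j (x j k z)) - scale (inverse q) (x j k (x i j z))))" for z
    by simp
  then show ?thesis using ne by (simp add: q_weyl_def)
qed

definition eigenbasis :: "(nat \<Rightarrow> 'b) \<Rightarrow> bool" where
  "eigenbasis u \<longleftrightarrow> is_basis scale d u \<and>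
     (\<forall>n\<le>d. x 0 2 (u n) = scale (q powi (int d - 2 * int n)) (u n))"

text \<open>The flag \<open>[3]\<close> starts with the eigenspace of \<open>x 3 0\<close> for \<open>q powi d\<close>, the first component of the
  decomposition \<open>[3,0]\<close>, so its membership condition is an eigenvector equation.\<close>

lemma ijkl_basis_iff:
  "ijkl_basis scale q x d 1 3 0 2 u \<longleftrightarrow>
     eigenbasis u \<and> x 3 0 (\<Sum>n\<le>d. u n) = scale (q powi int d) (\<Sum>n\<le>d. u n)"
proof -
  have "(3::4) + 1 = 0" by simp
  then have "flag scale q x d 3 0 = eigenspace scale (x 3 0) (q powi int d)"
    using span_eq_iff subspace_eigenspace[OF endo_generators(1)]
    unfolding flag_def by (simp only:) (simp add: decomposition_def std_gen_def)
  then show ?thesis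
    by (simp add: ijkl_basis_def eigenbasis_def decomposition_def std_gen_def)
       (auto simp: eigenspace_def)
qed

lemma eigenspaces:
  assumes "std_gen i j"
  shows "{e. eigenspace scale (x i j) e \<noteq> {0}} = {q powi (int d - 2 * int n) | n. n \<le> d}"
    and "diagonalizable scale (x i j)"
  using module assms
  by (simp_all add: evaluation_module_with_parameter_def evaluation_module_def has_diameter_type_def)

lemma ex_eigenvector:
  assumes "std_gen i j" "n \<le> d"
  shows "\<exists>z. z \<noteq> 0 \<and> x i j z = scale (q powi (int d - 2 * int n)) z"
proof -
  have "endo scale (x i j)" using boxq assms(1) by (simp add: boxq_module_def)
  then have "0 \<in> eigenspace scale (x i j) (q powi (int d - 2 * int n))"
    by (intro subspace_0 subspace_eigenspace)
  moreover have "eigenspace scale (x i j) (q powi (int d - 2 * int n)) \<noteq> {0}"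
    using eigenspaces(1)[OF assms(1)] assms(2) by blast
  ultimately show ?thesis by (auto simp: eigenspace_def)
qed

text \<open>There are \<open>d + 1\<close> eigenspaces of \<open>x 0 2\<close>, all of dimension 1, and together they span because
  \<open>x 0 2\<close> is diagonalizable.\<close>

lemma eigenbasis_exists: "\<exists>u. eigenbasis u"
proof -
  have gen: "std_gen 0 2" by (simp add: std_gen_def)
  let ?\<theta> = "\<lambda>n. q powi (int d - 2 * int n)"
  define u where "u n = (SOME z. z \<noteq> 0 \<and> x 0 2 z = scale (?\<theta> n) z)" for n
  have u: "u n \<noteq> 0" "x 0 2 (u n) = scale (?\<theta> n) (u n)" if "n \<le> d" for n
    using someI_ex[OF ex_eigenvector[OF gen that]] by (simp_all add: u_def)
  have "eigenspace scale (x 0 2) r \<subseteq> span (u ` {..d})" for r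
  proof (cases "eigenspace scale (x 0 2) r = {0}")
    case True
    then show ?thesis by (simp add: span_zero)
  next
    case False
    then obtain n where n: "n \<le> d" "r = ?\<theta> n" using eigenspaces(1)[OF gen] by blast
    have "\<forall>i j n. i \<noteq> j \<and> n \<le> d \<longrightarrow> dim (decomposition scale q x d i j n) = 1"
      using module by (simp add: evaluation_module_with_parameter_def evaluation_module_def)
    then have "dim (decomposition scale q x d 0 2 n) = 1" using n(1) by simp
    then have "dim (eigenspace scale (x 0 2) (?\<theta> n)) = 1"
      using gen by (simp add: decomposition_def)
    then have "eigenspace scale (x 0 2) (?\<theta> n) \<subseteq> span {u n}"
      by (rule subset_span_of_dim_1) (use u[OF n(1)] in \<open>simp_all add: eigenspace_def\<close>)
    also have "\<dots> \<subseteq> span (u ` {..d})" using n(1) by (intro span_mono) auto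
    finally show ?thesis using n(2) by simp
  qed
  then have "span (\<Union>r. eigenspace scale (x 0 2) r) \<subseteq> span (u ` {..d})"
    by (intro span_minimal) auto
  then have "span (u ` {..d}) = UNIV"
    using eigenspaces(2)[OF gen] by (auto simp: diagonalizable_def)
  moreover have "inj_on ?\<theta> {..d}" by (auto simp: inj_on_def q_powi_eq_iff)
  ultimately have "is_basis scale d u"
    using eigenvectors_independent[where u = u and Y = "x 0 2" and \<theta> = ?\<theta>, OF endo_generators(2)] u
    by (intro is_basisI) blast+
  with u show ?thesis by (auto simp: eigenbasis_def)
qed

lemma eigenbasis_x20:
  assumes "eigenbasis u" "n \<le> d"
  shows "x 2 0 (u n) = scale (inverse q powi (int d - 2 * int n)) (u n)"
proof -
  let ?r = "q powi (int d - 2 * int n)"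
  have "x 2 0 (x 0 2 z) = z" for z using boxq by (simp add: boxq_module_def)
  then have "scale ?r (x 2 0 (u n)) = u n"
    using assms by (metis eigenbasis_def endo_scale[OF endo_generators(5)])
  then have "scale (inverse ?r) (scale ?r (x 2 0 (u n))) = scale (inverse ?r) (u n)" by simp
  then show ?thesis using q_nonzero by (simp add: power_int_inverse)
qed

text \<open>The place where the evaluation parameter enters. In the basis defining \<open>V\<^sub>d(t)\<close> the first vector
  \<open>w 0\<close> spans the eigenspace of \<open>x 0 2\<close> for \<open>q powi (- d)\<close>, and applying \<open>x 3 0\<close> and then
  \<open>x 1 2\<close> to it does not lead out of the span of \<open>w 0\<close> and \<open>w 1\<close>. On an eigenbasis \<open>u\<close> of \<open>x 0 2\<close>, whose last
  vector is a multiple of \<open>w 0\<close>, the operator \<open>x 3 0 - q powi d\<close> sends \<open>u d\<close> to a multiple of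
  \<open>u (d - 1)\<close> and \<open>x 1 2 - q powi (2 - d)\<close> sends that back to a multiple of \<open>u d\<close>; the scalar below
  is thus the product \<open>e d * h d\<close> of two off-diagonal entries, expressed through \<open>t\<close>.\<close>

lemma parameter_on_lowest_vector:
  obtains w where "w \<noteq> 0" "x 0 2 w = scale (q powi (- int d)) w"
    and "x 1 2 (x 3 0 w - scale (q powi int d) w) - scale (q powi (2 - int d)) (x 3 0 w - scale (q powi int d) w)
      = scale (t * q powi (int d - 1) * (q powi int d - q powi (- int d))
          * (q powi (2 - int d) - q powi (- int d))) w"
proof -
  have "is_V scale q x d t" using module by (simp add: evaluation_module_with_parameter_def)
  then obtain w where basis: "is_basis scale d w"
    and E: "represents scale d w (E_mat d q) (x 1 2)"
    and G: "represents scale d w (Z_mat d * G_mat d (inverse q) t * Z_mat d) (x 3 0)"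
    and L: "represents scale d w (L_mat d q t) (x 0 2)"
    unfolding is_V_def by blast
  \<comment> \<open>\<open>Z\<close> reverses the order of the basis, so the first column of \<open>Z G Z\<close> is the last one of \<open>G\<close>, read
    upwards.\<close>
  have flip: "(Z_mat d * M * Z_mat d) $$ (i, j) = M $$ (d - i, d - j)"
    if M: "M \<in> carrier_mat (d+1) (d+1)" and ij: "i \<le> d" "j \<le> d" for M :: "'a mat" and i j
  proof -
    have ZM: "(Z_mat d * M) $$ (i, k) = M $$ (d - i, k)" if k: "k \<le> d" for k
    proof -
      have "(Z_mat d * M) $$ (i, k) = (\<Sum>m<d+1. (if i + m = d then 1 else 0) * M $$ (m, k))"
        using M ij k by (simp add: Z_mat_def times_mat_def scalar_prod_def atLeast0LessThan del: sum.lessThan_Suc)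
      also have "\<dots> = (\<Sum>m<d+1. if m = d - i then M $$ (d - i, k) else 0)"
        using ij by (intro sum.cong) auto
      finally show ?thesis by simp
    qed
    have "(Z_mat d * M * Z_mat d) $$ (i, j)
        = (\<Sum>m<d+1. (Z_mat d * M) $$ (i, m) * (if m + j = d then 1 else 0))"
      using M ij by (simp add: Z_mat_def times_mat_def scalar_prod_def atLeast0LessThan del: sum.lessThan_Suc)
    also have "\<dots> = (\<Sum>m<d+1. if m = d - j then M $$ (d - i, d - j) else 0)"
      using ij by (intro sum.cong) (auto simp: ZM)
    finally show ?thesis by simp
  qed
  let ?h = "(q powi (- int d) - q powi (2 - int d)) * (1 - t * q powi (int d - 1))"
  have d: "0 \<le> d" "1 \<le> d" "0 < d" using d_pos by simp_all
  have two: "(\<Sum>i\<le>d. scale (M i) (w i)) = scale (M 0) (w 0) + scale (M 1) (w 1)"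
    if "\<And>i. 1 < i \<Longrightarrow> i \<le> d \<Longrightarrow> M i = 0" for M
  proof -
    have "(\<Sum>i\<le>d. scale (M i) (w i)) = (\<Sum>i\<in>{0,1}. scale (M i) (w i))"
    proof (intro sum.mono_neutral_right ballI)
      fix i assume "i \<in> {..d} - {0, 1}"
      then have "M i = 0" by (intro that) auto
      then show "scale (M i) (w i) = 0" by simp
    qed (use d in auto)
    then show ?thesis by simp
  qed
  have x02: "x 0 2 (w 0) = scale (q powi (- int d)) (w 0)"
  proof -
    have "x 0 2 (w 0) = (\<Sum>i\<le>d. scale (L_mat d q t $$ (i, 0)) (w i))"
      using L by (simp add: represents_def)
    also have "\<dots> = scale (L_mat d q t $$ (0, 0)) (w 0) + scale (L_mat d q t $$ (1, 0)) (w 1)"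
      by (rule two) (simp add: L_mat_def)
    finally show ?thesis using d by (simp add: L_mat_def)
  qed
  have x12: "x 1 2 (w 0) = scale (q powi (- int d)) (w 0)"
    "x 1 2 (w 1) = scale (q powi int d - q powi (- int d)) (w 0) + scale (q powi (2 - int d)) (w 1)"
  proof -
    have *: "x 1 2 (w n) = scale (E_mat d q $$ (0, n)) (w 0) + scale (E_mat d q $$ (1, n)) (w 1)"
      if n: "n \<le> 1" for n
    proof -
      have "x 1 2 (w n) = (\<Sum>i\<le>d. scale (E_mat d q $$ (i, n)) (w i))"
        using E n d by (simp add: represents_def)
      also have "\<dots> = scale (E_mat d q $$ (0, n)) (w 0) + scale (E_mat d q $$ (1, n)) (w 1)"
        using n d by (intro two) (auto simp add: E_mat_def)
      finally show ?thesis .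
    qed
    show "x 1 2 (w 0) = scale (q powi (- int d)) (w 0)"
      using d *[of 0] by (simp add: E_mat_def)
    show "x 1 2 (w 1) = scale (q powi int d - q powi (- int d)) (w 0) + scale (q powi (2 - int d)) (w 1)"
      using d *[of 1] by (simp add: E_mat_def)
  qed
  have x30: "x 3 0 (w 0) = scale (q powi (- int d)) (w 0) + scale ?h (w 1)"
  proof -
    let ?M = "Z_mat d * G_mat d (inverse q) t * Z_mat d"
    have M: "?M $$ (i, 0) = G_mat d (inverse q) t $$ (d - i, d)" if "i \<le> d" for i
      using flip[of "G_mat d (inverse q) t" i 0] that by (simp add: G_mat_def)
    have "x 3 0 (w 0) = (\<Sum>i\<le>d. scale (?M $$ (i, 0)) (w i))"
      using G by (simp add: represents_def)
    also have "\<dots> = scale (?M $$ (0, 0)) (w 0) + scale (?M $$ (1, 0)) (w 1)"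
      by (rule two, subst M) (auto simp: G_mat_def)
    also have "?M $$ (0, 0) = q powi (- int d)"
      unfolding M[OF d(1)] by (simp add: G_mat_def power_int_inverse power_int_minus power_inverse)
    also have "?M $$ (1, 0) = ?h"
    proof -
      have *: "inverse q powi k = q powi (- k)" for k by (simp add: power_int_inverse power_int_minus)
      have "int d - 2 * int d + 1 = 1 - int d" "- (2 * int d - 2 - int d) = 2 - int d" by simp_all
      then show ?thesis
        unfolding M[OF d(2)] using d by (auto simp: G_mat_def * of_nat_diff power_inverse power_int_minus)
    qed
    finally show ?thesis .
  qed
  note linear = endo_add[OF endo_generators(6)] endo_scale[OF endo_generators(6)] endo_diff[OF endo_generators(6)]
  let ?y = "x 3 0 (w 0) - scale (q powi int d) (w 0)"
  have y: "?y = scale (q powi (- int d) - q powi int d) (w 0) + scale ?h (w 1)"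
    by (simp add: x30 scale_left_diff_distrib)
  have "x 1 2 ?y - scale (q powi (2 - int d)) ?y
      = scale ((q powi (- int d) - q powi int d) * (q powi (- int d) - q powi (2 - int d))
          + ?h * (q powi int d - q powi (- int d))) (w 0)"
    unfolding y by (simp add: linear x12[unfolded One_nat_def] scale_right_distrib scale_left_distrib scale_left_diff_distrib
        scale_right_diff_distrib algebra_simps)
  also have "(q powi (- int d) - q powi int d) * (q powi (- int d) - q powi (2 - int d))
          + ?h * (q powi int d - q powi (- int d))
      = t * q powi (int d - 1) * (q powi int d - q powi (- int d))
          * (q powi (2 - int d) - q powi (- int d))"
    by (simp add: algebra_simps)
  finally show thesis using that x02 basis_nonzero[OF basis d(1)] by blast
qed

lemma inverse_q_powi: "inverse q powi k = q powi (- k)"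
  by (simp add: power_int_inverse power_int_minus)

text \<open>The matrices of the generators on an eigenbasis of \<open>x 0 2\<close>, up to the rescaling of the basis
  vectors. The relations come from the two equitable triples and from the pair \<open>x 1 2\<close>, \<open>x 2 3\<close>, which
  links the triples; the final equation carries the evaluation parameter.\<close>

lemma bidiagonal_actions:
  assumes u: "eigenbasis u"
  obtains e f g h where
    "\<And>n. n \<le> d \<Longrightarrow> x 3 0 (u n) = scale (q powi (2 * int n - int d)) (u n)
       + (if n = 0 then 0 else scale (e n) (u (n - 1)))"
    "\<And>n. n \<le> d \<Longrightarrow> x 2 3 (u n) = scale (q powi (2 * int n - int d)) (u n)
       + (if n = d then 0 else scale (f (Suc n)) (u (Suc n)))"
    "\<And>n. n \<le> d \<Longrightarrow> x 0 1 (u n) = scale (q powi (int d - 2 * int n)) (u n)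
       + (if n = 0 then 0 else scale (g n) (u (n - 1)))"
    "\<And>n. n \<le> d \<Longrightarrow> x 1 2 (u n) = scale (q powi (int d - 2 * int n)) (u n)
       + (if n = d then 0 else scale (h (Suc n)) (u (Suc n)))"
    "\<And>n. 1 \<le> n \<Longrightarrow> n \<le> d \<Longrightarrow>
       e n * f n = (1 - q powi (2 * int n)) * (1 - q powi (2 * int n - 2 * int d - 2))"
    "\<And>n. 1 \<le> n \<Longrightarrow> n \<le> d \<Longrightarrow>
       g n * h n = (1 - q powi (- 2 * int n)) * (1 - q powi (2 * int d - 2 * int n + 2))"
    "\<And>n. 1 \<le> n \<Longrightarrow> n < d \<Longrightarrow> q * h (Suc n) * f n = inverse q * f (Suc n) * h n"
    "e d * h d = t * q powi (int d - 1) * (q powi int d - q powi (- int d))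
       * (q powi (2 - int d) - q powi (- int d))"
proof -
  have basis: "is_basis scale d u"
    and x02: "\<And>n. n \<le> d \<Longrightarrow> x 0 2 (u n) = scale (q powi (int d - 2 * int n)) (u n)"
    using u by (simp_all add: eigenbasis_def)
  note x20 = eigenbasis_x20[OF u]
  have weyl: "q_weyl scale q (x 3 0) (x 0 2)" "q_weyl scale q (x 0 2) (x 2 3)"
    "q_weyl scale q (x 2 3) (x 3 0)" "q_weyl scale q (x 2 0) (x 0 1)"
    "q_weyl scale q (x 1 2) (x 2 0)" "q_weyl scale q (x 0 1) (x 1 2)"
    "q_weyl scale q (x 1 2) (x 2 3)"
    by (rule q_weyl_generators, simp)+
  note inv = q_weyl_inverse[OF weyl(4)] q_weyl_inverse[OF weyl(5)] q_weyl_inverse[OF weyl(6)]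
  have q': "inverse q \<noteq> 0" using q_nonzero by simp
  obtain e where e: "\<And>n. n \<le> d \<Longrightarrow> x 3 0 (u n) = scale (q powi (2 * int n - int d)) (u n)
       + (if n = 0 then 0 else scale (e n) (u (n - 1)))"
    using q_weyl_lowering[OF basis q_nonzero q_not_root weyl(1) endo_generators(1,2) x02] by blast
  obtain f where f: "\<And>n. n \<le> d \<Longrightarrow> x 2 3 (u n) = scale (q powi (2 * int n - int d)) (u n)
       + (if n = d then 0 else scale (f (Suc n)) (u (Suc n)))"
    using q_weyl_raising[OF basis q_nonzero q_not_root weyl(2) endo_generators(3,2) x02] by blast
  obtain g where g': "\<And>n. n \<le> d \<Longrightarrow> x 0 1 (u n) = scale (inverse q powi (2 * int n - int d)) (u n)
       + (if n = 0 then 0 else scale (g n) (u (n - 1)))"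
    using q_weyl_lowering[OF basis q' inverse_q_not_root inv(1) endo_generators(4,5) x20] by blast
  obtain h where h': "\<And>n. n \<le> d \<Longrightarrow> x 1 2 (u n) = scale (inverse q powi (2 * int n - int d)) (u n)
       + (if n = d then 0 else scale (h (Suc n)) (u (Suc n)))"
    using q_weyl_raising[OF basis q' inverse_q_not_root inv(2) endo_generators(6,5) x20] by blast
  have g: "x 0 1 (u n) = scale (q powi (int d - 2 * int n)) (u n)
       + (if n = 0 then 0 else scale (g n) (u (n - 1)))" if "n \<le> d" for n
    using g'[OF that] by (simp add: inverse_q_powi)
  have h: "x 1 2 (u n) = scale (q powi (int d - 2 * int n)) (u n)
       + (if n = d then 0 else scale (h (Suc n)) (u (Suc n)))" if "n \<le> d" for n
    using h'[OF that] by (simp add: inverse_q_powi)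
  have ef: "e n * f n = (1 - q powi (2 * int n)) * (1 - q powi (2 * int n - 2 * int d - 2))"
    if "1 \<le> n" "n \<le> d" for n
    by (rule equitable_product[OF basis q_nonzero weyl(3) endo_generators(3,1) e f that])
  have gh: "g n * h n = (1 - q powi (- 2 * int n)) * (1 - q powi (2 * int d - 2 * int n + 2))"
    if "1 \<le> n" "n \<le> d" for n
    using equitable_product[OF basis q' inv(3) endo_generators(6,4) g' h' that]
    by (simp add: inverse_q_powi algebra_simps)
  have hf: "q * h (Suc n) * f n = inverse q * f (Suc n) * h n" if n: "1 \<le> n" "n < d" for n
  proof -
    obtain m where m: "n = Suc m" using n(1) by (cases n) auto
    \<comment> \<open>Compare the coefficients of \<open>u (n + 1)\<close> in the relation applied to \<open>u (n - 1)\<close>.\<close>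
    let ?c = "coord d u (Suc n)"
    note linear = coord_add[OF basis] coord_scale[OF basis] coord_basis[OF basis]
      endo_add[OF endo_generators(3)] endo_scale[OF endo_generators(3)]
      endo_add[OF endo_generators(6)] endo_scale[OF endo_generators(6)]
    have hf: "?c (x 1 2 (x 2 3 (u m))) = h (Suc n) * f n"
      using n(2) m by (simp add: f h linear)
    have fh: "?c (x 2 3 (x 1 2 (u m))) = f (Suc n) * h n"
      using n(2) m by (simp add: f h linear)
    have "?c (scale q (x 1 2 (x 2 3 (u m))) - scale (inverse q) (x 2 3 (x 1 2 (u m))))
        = ?c (scale (q - inverse q) (u m))"
      using weyl(7) by (simp add: q_weyl_def)
    then have "q * (h (Suc n) * f n) - inverse q * (f (Suc n) * h n) = 0"
      unfolding coord_diff[OF basis] coord_scale[OF basis] hf fh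
      using n(2) m by (simp add: coord_basis[OF basis])
    then show ?thesis by (simp add: mult.assoc)
  qed
  have eh: "e d * h d = t * q powi (int d - 1) * (q powi int d - q powi (- int d))
       * (q powi (2 - int d) - q powi (- int d))" (is "_ = ?r")
  proof -
    note linear = endo_add[OF endo_generators(6)] endo_scale[OF endo_generators(6)]
      endo_diff[OF endo_generators(6)] endo_scale[OF endo_generators(1)]
    define \<Phi> where "\<Phi> y = x 1 2 (x 3 0 y - scale (q powi int d) y)
      - scale (q powi (2 - int d)) (x 3 0 y - scale (q powi int d) y)" for y
    have \<Phi>_scale: "\<Phi> (scale k y) = scale k (\<Phi> y)" for k y
      by (simp add: \<Phi>_def linear scale_right_diff_distrib mult.commute)
    obtain w where w: "w \<noteq> 0" "x 0 2 w = scale (q powi (- int d)) w" "\<Phi> w = scale ?r w"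
      using parameter_on_lowest_vector unfolding \<Phi>_def by blast
    have inj: "inj_on (\<lambda>n. q powi (int d - 2 * int n)) {..d}"
      by (auto simp: inj_on_def q_powi_eq_iff)
    have lowest: "x 0 2 w = scale (q powi (int d - 2 * int d)) w" using w(2) by simp
    have w_u: "w = scale (coord d u d w) (u d)"
      by (rule eigenvector_on_line[OF basis endo_generators(2) x02 inj lowest order_refl])
    have "\<Phi> (scale (coord d u d w) (u d)) = scale ?r (scale (coord d u d w) (u d))"
      using w(3) w_u by simp
    then have "scale (coord d u d w) (\<Phi> (u d)) = scale (coord d u d w) (scale ?r (u d))"
      unfolding \<Phi>_scale by (simp only: scale_left_commute)
    moreover have "coord d u d w \<noteq> 0" using w(1) w_u by auto
    ultimately have "\<Phi> (u d) = scale ?r (u d)" by (metis scale_left_imp_eq)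
    moreover have "\<Phi> (u d) = scale (e d * h d) (u d)"
    proof -
      have idx: "int d - 2 * int (d - 1) = 2 - int d" "d - 1 \<noteq> d" "Suc (d - 1) = d" "d \<noteq> 0"
        using d_pos by (simp_all add: of_nat_diff)
      have low: "x 3 0 (u d) - scale (q powi int d) (u d) = scale (e d) (u (d - 1))"
        using e[of d] idx(4) by simp
      have up: "x 1 2 (u (d - 1)) = scale (q powi (2 - int d)) (u (d - 1)) + scale (h d) (u d)"
        using h[of "d - 1"] idx by simp
      show ?thesis
        unfolding \<Phi>_def low linear up by (simp add: scale_right_distrib scale_left_commute)
    qed
    ultimately have "scale (e d * h d) (u d) = scale ?r (u d)" by simp
    then show ?thesis using basis_nonzero[OF basis, of d] by simp
  qed
  show thesis by (rule that[OF e f g h ef gh hf eh])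
qed

text \<open>The wanted basis consists of the components, along an eigenbasis of \<open>x 0 2\<close>, of an eigenvector
  \<open>y\<close> of \<open>x 3 0\<close> for \<open>q powi d\<close>. None of them is 0: as \<open>x 3 0\<close> is bidiagonal with distinct diagonal
  entries and nonzero superdiagonal entries, two consecutive components of \<open>y\<close> vanish together.\<close>

lemma ijkl_basis_exists: "\<exists>u. ijkl_basis scale q x d 1 3 0 2 u"
proof -
  obtain u where u: "eigenbasis u" using eigenbasis_exists ..
  then have basis: "is_basis scale d u" by (simp add: eigenbasis_def)
  obtain e f where e: "\<And>n. n \<le> d \<Longrightarrow> x 3 0 (u n) = scale (q powi (2 * int n - int d)) (u n)
       + (if n = 0 then 0 else scale (e n) (u (n - 1)))"
    and ef: "\<And>n. 1 \<le> n \<Longrightarrow> n \<le> d \<Longrightarrow>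
       e n * f n = (1 - q powi (2 * int n)) * (1 - q powi (2 * int n - 2 * int d - 2))"
    using bidiagonal_actions[OF u] by metis
  have "std_gen 3 0" by (simp add: std_gen_def)
  from ex_eigenvector[OF this, of 0]
  obtain y where y: "y \<noteq> 0" "x 3 0 y = scale (q powi int d) y" by auto
  let ?c = "\<lambda>n. coord d u n y"
  have step: "(q powi int d - q powi (2 * int n - int d)) * ?c n = e (Suc n) * ?c (Suc n)"
    if "n < d" for n
    using coord_lowering[OF basis endo_generators(1) e, of n y] that
    by (simp add: y(2) coord_scale[OF basis] algebra_simps)
  have e_nonzero: "e (Suc n) \<noteq> 0" if "n < d" for n
  proof -
    have "q powi (2 * int (Suc n)) \<noteq> 1" "q powi (2 * int (Suc n) - 2 * int d - 2) \<noteq> 1"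
      unfolding q_powi_eq_1_iff using that by auto
    then have "e (Suc n) * f (Suc n) \<noteq> 0"
      by (subst ef) (use that in \<open>simp_all del: of_nat_Suc\<close>)
    then show ?thesis by auto
  qed
  have diag_nonzero: "q powi int d - q powi (2 * int n - int d) \<noteq> 0" if "n < d" for n
    using that by (simp add: q_powi_eq_iff del: power_int_of_nat)
  \<comment> \<open>Hence one vanishing component of \<open>y\<close> makes all of them vanish.\<close>
  have zero_iff: "?c n = 0 \<longleftrightarrow> ?c (Suc n) = 0" if "n < d" for n
    using step[OF that] e_nonzero[OF that] diag_nonzero[OF that] by (metis mult_eq_0_iff)
  have all_zero: "?c n = 0 \<longleftrightarrow> ?c d = 0" if "n \<le> d" for n
    using that by (induction rule: inc_induct) (simp_all add: zero_iff)
  have "?c n \<noteq> 0" if n: "n \<le> d" for n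
  proof
    assume "?c n = 0"
    then have "\<forall>m\<le>d. ?c m = 0" using all_zero n by blast
    then have "(\<Sum>m\<le>d. scale (?c m) (u m)) = 0" by simp
    then show False using y(1) coord_expansion[OF basis, of y] by simp
  qed
  then have "is_basis scale d (\<lambda>n. scale (?c n) (u n))"
    by (rule is_basis_rescale[OF basis])
  then have "eigenbasis (\<lambda>n. scale (?c n) (u n))"
    using u by (simp add: eigenbasis_def endo_scale[OF endo_generators(2)] scale_left_commute)
  moreover have "(\<Sum>n\<le>d. scale (?c n) (u n)) = y" by (rule coord_expansion[OF basis])
  ultimately show ?thesis using y(2) by (auto simp: ijkl_basis_iff)
qed

end

section \<open>The normalized eigenbasis\<close>

context evaluation_module_space
begin

text \<open>Since the sum of the \<open>u n\<close> is an eigenvector of \<open>x 3 0\<close>, every row of the matrix of \<open>x 3 0\<close> has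
  sum \<open>q powi d\<close>; this gives \<open>e n\<close>, and division gives \<open>f n\<close>. The entries \<open>h n\<close> follow by descent from
  \<open>h d\<close>, and \<open>g n\<close> again by division.\<close>

lemma normalized_actions:
  assumes u: "ijkl_basis scale q x d 1 3 0 2 u" and t: "t \<noteq> 0"
  shows "n \<le> d \<Longrightarrow> x 3 0 (u n) = scale (q powi (2 * int n - int d)) (u n)
       + (if n = 0 then 0 else scale (q powi int d * (1 - q powi (2 * int n - 2 * int d - 2))) (u (n - 1)))"
    and "n \<le> d \<Longrightarrow> x 2 3 (u n) = scale (q powi (2 * int n - int d)) (u n)
       + (if n = d then 0 else scale (q powi (- int d) * (1 - q powi (2 * int (Suc n)))) (u (Suc n)))"
    and "n \<le> d \<Longrightarrow> x 0 1 (u n) = scale (q powi (int d - 2 * int n)) (u n)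
       + (if n = 0 then 0 else scale (inverse (t * q) * (1 - q powi (2 * int d - 2 * int n + 2))) (u (n - 1)))"
    and "n \<le> d \<Longrightarrow> x 1 2 (u n) = scale (q powi (int d - 2 * int n)) (u n)
       + (if n = d then 0 else scale (t * q * (1 - q powi (- 2 * int (Suc n)))) (u (Suc n)))"
proof -
  have eigenbasis: "eigenbasis u"
    and top: "x 3 0 (\<Sum>n\<le>d. u n) = scale (q powi int d) (\<Sum>n\<le>d. u n)"
    using u by (simp_all add: ijkl_basis_iff)
  then have basis: "is_basis scale d u" by (simp add: eigenbasis_def)
  from bidiagonal_actions[OF eigenbasis] obtain e f g h where
    e: "\<And>n. n \<le> d \<Longrightarrow> x 3 0 (u n) = scale (q powi (2 * int n - int d)) (u n)
       + (if n = 0 then 0 else scale (e n) (u (n - 1)))" and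
    f: "\<And>n. n \<le> d \<Longrightarrow> x 2 3 (u n) = scale (q powi (2 * int n - int d)) (u n)
       + (if n = d then 0 else scale (f (Suc n)) (u (Suc n)))" and
    g: "\<And>n. n \<le> d \<Longrightarrow> x 0 1 (u n) = scale (q powi (int d - 2 * int n)) (u n)
       + (if n = 0 then 0 else scale (g n) (u (n - 1)))" and
    h: "\<And>n. n \<le> d \<Longrightarrow> x 1 2 (u n) = scale (q powi (int d - 2 * int n)) (u n)
       + (if n = d then 0 else scale (h (Suc n)) (u (Suc n)))" and
    ef: "\<And>n. 1 \<le> n \<Longrightarrow> n \<le> d \<Longrightarrow>
       e n * f n = (1 - q powi (2 * int n)) * (1 - q powi (2 * int n - 2 * int d - 2))" and
    gh: "\<And>n. 1 \<le> n \<Longrightarrow> n \<le> d \<Longrightarrow>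
       g n * h n = (1 - q powi (- 2 * int n)) * (1 - q powi (2 * int d - 2 * int n + 2))" and
    hf: "\<And>n. 1 \<le> n \<Longrightarrow> n < d \<Longrightarrow> q * h (Suc n) * f n = inverse q * f (Suc n) * h n" and
    eh: "e d * h d = t * q powi (int d - 1) * (q powi int d - q powi (- int d))
       * (q powi (2 - int d) - q powi (- int d))"
    by blast
  have e_eq: "e n = q powi int d * (1 - q powi (2 * int n - 2 * int d - 2))" if n: "1 \<le> n" "n \<le> d" for n
  proof -
    obtain m where m: "n = Suc m" using n(1) by (cases n) auto
    have c: "coord d u k (\<Sum>i\<le>d. u i) = 1" if "k \<le> d" for k
      using that by (simp add: coord_sum[OF basis] coord_basis[OF basis])
    \<comment> \<open>Row \<open>m\<close> of the eigenvector equation for the sum of the basis vectors.\<close>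
    have "q powi int d = q powi (2 * int m - int d) + e n"
      using coord_lowering[OF basis endo_generators(1) e, of m "\<Sum>i\<le>d. u i"] n m
      by (simp add: top coord_scale[OF basis] c)
    moreover have "q powi (2 * int m - int d) = q powi int d * q powi (2 * int n - 2 * int d - 2)"
      by (subst power_int_add[OF disjI1[OF q_nonzero], symmetric]) (simp add: m)
    ultimately have "q powi int d * (1 - q powi (2 * int n - 2 * int d - 2)) = q powi int d - q powi (2 * int m - int d)"
      by (simp add: right_diff_distrib)
    with \<open>q powi int d = q powi (2 * int m - int d) + e n\<close> show ?thesis by simp
  qed
  have f_eq: "f n = q powi (- int d) * (1 - q powi (2 * int n))" if n: "1 \<le> n" "n \<le> d" for n
  proof -
    let ?y = "1 - q powi (2 * int n - 2 * int d - 2)"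
    have y: "?y \<noteq> 0" using n by (simp add: q_powi_eq_1_iff)
    have "?y * (q powi int d * f n) = ?y * (1 - q powi (2 * int n))"
      using ef[OF n] unfolding e_eq[OF n] by (simp only: mult_ac)
    then have "q powi int d * f n = 1 - q powi (2 * int n)"
      by (rule iffD1[OF mult_left_cancel[OF y]])
    then show ?thesis using q_nonzero by (simp add: power_int_minus field_simps)
  qed
  have h_top: "h d = t * q * (1 - q powi (- 2 * int d))"
  proof -
    let ?D = "q powi int d"
    have D: "?D \<noteq> 0" and q2: "q\<^sup>2 \<noteq> 1" using q_nonzero q_not_root[of 2] by simp_all
    have pow: "q powi (int d - 1) = ?D / q" "q powi (- int d) = 1 / ?D"
      "q powi (2 - int d) = q\<^sup>2 / ?D" "q powi (- 2 * int d) = 1 / ?D\<^sup>2"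
      using q_nonzero by (simp_all add: power_int_diff power_int_minus power_int_mult field_simps
          power_mult_distrib flip: power_mult)
    have e_top: "e d = ?D * (1 - 1 / q\<^sup>2)"
      using e_eq[of d] d_pos by (simp add: power_int_minus field_simps)
    have "e d \<noteq> 0" and "e d * (t * q * (1 - q powi (- 2 * int d))) = e d * h d"
      unfolding eh unfolding pow e_top using D q2 q_nonzero by (simp_all add: field_simps power2_eq_square)
    then show ?thesis by (metis mult_left_cancel)
  qed
  have h_eq: "h n = t * q * (1 - q powi (- 2 * int n))" if n: "1 \<le> n" "n \<le> d" for n
    using n(2,1)
  proof (induction rule: inc_induct)
    case base
    show ?case by (rule h_top)
  next
    case (step n)
    let ?Y = "q powi (2 * int n)"
    have Y: "?Y \<noteq> 0" and Y1: "1 - q\<^sup>2 * ?Y \<noteq> 0"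
    proof -
      have "q\<^sup>2 * ?Y = q powi (2 + 2 * int n)" using q_nonzero by (simp add: power_int_add)
      then show "1 - q\<^sup>2 * ?Y \<noteq> 0" by (simp add: q_powi_eq_1_iff)
    qed (use q_nonzero in simp)
    have hS: "h (Suc n) = t * q * (1 - 1 / (q\<^sup>2 * ?Y))"
    proof -
      have "q powi (- 2 * int (Suc n)) = 1 / (q\<^sup>2 * ?Y)"
        using q_nonzero by (simp add: power_int_minus power_int_add power_int_diff field_simps)
      then show ?thesis using step by simp
    qed
    have fS: "f (Suc n) = q powi (- int d) * (1 - q\<^sup>2 * ?Y)"
    proof -
      have "q powi (2 * int (Suc n)) = q\<^sup>2 * ?Y" using q_nonzero by (simp add: power_int_add)
      then show ?thesis using f_eq[of "Suc n"] step by simp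
    qed
    have fn: "f n = q powi (- int d) * (1 - ?Y)" using f_eq step by simp
    let ?D = "q powi (- int d)"
    have D: "?D \<noteq> 0" using q_nonzero by simp
    have "q * h (Suc n) * f n = inverse q * f (Suc n) * h n"
      using hf[of n] step.hyps(2) step.prems by simp
    then have rel: "inverse q * (?D * (1 - q\<^sup>2 * ?Y)) * h n
        = q * (t * q * (1 - 1 / (q\<^sup>2 * ?Y))) * (?D * (1 - ?Y))"
      unfolding hS fS fn by (rule sym)
    have "(1 - q\<^sup>2 * ?Y) * h n = (q / ?D) * (inverse q * (?D * (1 - q\<^sup>2 * ?Y)) * h n)"
      using D q_nonzero by simp
    also have "\<dots> = (q / ?D) * (q * (t * q * (1 - 1 / (q\<^sup>2 * ?Y))) * (?D * (1 - ?Y)))"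
      by (simp only: rel)
    also have "\<dots> = (1 - q\<^sup>2 * ?Y) * (t * q * (1 - 1 / ?Y))"
    proof -
      have "(q / D') * (q * (t * q * (1 - 1 / (q\<^sup>2 * y))) * (D' * (1 - y)))
          = (1 - q\<^sup>2 * y) * (t * q * (1 - 1 / y))" if "D' \<noteq> 0" "y \<noteq> 0" for D' y
        using that q_nonzero by (simp add: field_simps power2_eq_square)
      from this[OF D Y] show ?thesis .
    qed
    finally have "h n = t * q * (1 - 1 / ?Y)" by (rule iffD1[OF mult_left_cancel[OF Y1]])
    then show ?case by (simp add: power_int_minus inverse_eq_divide)
  qed
  have g_eq: "g n = inverse (t * q) * (1 - q powi (2 * int d - 2 * int n + 2))" if n: "1 \<le> n" "n \<le> d" for n
  proof -
    let ?z = "1 - q powi (- 2 * int n)" and ?w = "1 - q powi (2 * int d - 2 * int n + 2)"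
    have z: "?z \<noteq> 0"
      using n by (simp add: q_powi_eq_1_iff del: power_int_minus)
    have "?z * (t * q * g n) = ?z * ?w"
      using gh[OF n] unfolding h_eq[OF n] by (simp only: mult_ac)
    then have "t * q * g n = ?w" by (rule iffD1[OF mult_left_cancel[OF z]])
    moreover have "g n = inverse (t * q) * (t * q * g n)" using q_nonzero t by (simp add: field_simps)
    ultimately show ?thesis by (simp only:)
  qed
  show "n \<le> d \<Longrightarrow> x 3 0 (u n) = scale (q powi (2 * int n - int d)) (u n)
       + (if n = 0 then 0 else scale (q powi int d * (1 - q powi (2 * int n - 2 * int d - 2))) (u (n - 1)))"
    using e[of n] e_eq[of n] by auto
  show "n \<le> d \<Longrightarrow> x 2 3 (u n) = scale (q powi (2 * int n - int d)) (u n)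
       + (if n = d then 0 else scale (q powi (- int d) * (1 - q powi (2 * int (Suc n)))) (u (Suc n)))"
    using f[of n] f_eq[of "Suc n"] by auto
  show "n \<le> d \<Longrightarrow> x 0 1 (u n) = scale (q powi (int d - 2 * int n)) (u n)
       + (if n = 0 then 0 else scale (inverse (t * q) * (1 - q powi (2 * int d - 2 * int n + 2))) (u (n - 1)))"
    using g[of n] g_eq[of n] by auto
  show "n \<le> d \<Longrightarrow> x 1 2 (u n) = scale (q powi (int d - 2 * int n)) (u n)
       + (if n = d then 0 else scale (t * q * (1 - q powi (- 2 * int (Suc n)))) (u (Suc n)))"
    using h[of n] h_eq[of "Suc n"] by auto
qed

end

section \<open>Operators given by bidiagonal and tridiagonal matrices\<close>

context operator_space
begin

lemma tridiagonal_column: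
  assumes tri: "\<And>i. i \<le> d \<Longrightarrow> i > Suc n \<or> n > Suc i \<Longrightarrow> M i = 0" and n: "n \<le> d"
  shows "(\<Sum>i\<le>d. scale (M i) (v i)) = scale (M n) (v n)
    + (if n = d then 0 else scale (M (Suc n)) (v (Suc n)))
    + (if n = 0 then 0 else scale (M (n - 1)) (v (n - 1)))"
proof -
  have "(\<Sum>i\<le>d. scale (M i) (v i))
      = (\<Sum>i\<le>d. (if i = n then scale (M n) (v n) else 0)
          + (if i = Suc n then scale (M (Suc n)) (v (Suc n)) else 0)
          + (if i = n - 1 then (if n = 0 then 0 else scale (M (n - 1)) (v (n - 1))) else 0))"
  proof (intro sum.cong refl)
    fix i assume i: "i \<in> {..d}"
    consider "i = n" | "i = Suc n" | "Suc i = n" | "i > Suc n \<or> n > Suc i" by linarith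
    then show "scale (M i) (v i) = (if i = n then scale (M n) (v n) else 0)
          + (if i = Suc n then scale (M (Suc n)) (v (Suc n)) else 0)
          + (if i = n - 1 then (if n = 0 then 0 else scale (M (n - 1)) (v (n - 1))) else 0)"
      using tri[of i] i n by cases auto
  qed
  also have "\<dots> = scale (M n) (v n)
      + (if n = d then 0 else scale (M (Suc n)) (v (Suc n)))
      + (if n = 0 then 0 else scale (M (n - 1)) (v (n - 1)))"
    using n by (auto simp: sum.distrib)
  finally show ?thesis .
qed

lemma represents_intertwine:
  assumes "is_basis scale d v" "represents scale d v M f" "represents scale d v' M f"
    and f: "endo scale f" and T: "endo scale T" "\<And>n. n \<le> d \<Longrightarrow> T (v n) = v' n"
  shows "T (f y) = f (T y)"
proof -
  have "endo scale (\<lambda>y. T (f y))" "endo scale (\<lambda>y. f (T y))"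
    by (rule endoI; simp add: endo_add[OF f] endo_add[OF T(1)] endo_scale[OF f] endo_scale[OF T(1)])+
  then show ?thesis
  proof (rule endo_eqI[OF assms(1)])
    fix n assume n: "n \<le> d"
    then have "T (f (v n)) = (\<Sum>i\<le>d. scale (M $$ (i, n)) (v' i))"
      using assms(2) T(2) by (simp add: represents_def endo_sum[OF T(1)] endo_scale[OF T(1)])
    also have "\<dots> = f (T (v n))" using assms(3) T(2) n by (simp add: represents_def)
    finally show "T (f (v n)) = f (T (v n))" .
  qed
qed

lemma ex_change_of_basis:
  assumes "is_basis scale d v"
  shows "\<exists>T. endo scale T \<and> (\<forall>n\<le>d. T (v n) = v' n)"
proof (intro exI conjI allI impI)
  let ?T = "\<lambda>y. \<Sum>i\<le>d. scale (coord d v i y) (v' i)"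
  show "endo scale ?T"
    by (rule endoI) (simp_all add: coord_add[OF assms] coord_scale[OF assms] scale_left_distrib
        sum.distrib scale_sum_right)
  fix n assume n: "n \<le> d"
  have "?T (v n) = (\<Sum>i\<le>d. if i = n then v' n else 0)"
    using n by (intro sum.cong) (auto simp: coord_basis[OF assms])
  then show "?T (v n) = v' n" using n by simp
qed

text \<open>The eigenspace of \<open>B\<close> for \<open>\<theta>' 0\<close> is the line through \<open>s 0\<close>, since \<open>B\<close> is upper triangular with
  distinct diagonal entries; so \<open>T\<close> acts on \<open>s 0\<close> as a scalar \<open>r\<close>. The vector \<open>s 0\<close> generates the whole
  space under \<open>A\<close>, so \<open>T\<close> is this scalar everywhere.\<close>

lemma split_form_centralizer:
  assumes basis: "is_basis scale d s"
    and A: "represents scale d s (lower_split_mat d \<theta>) A" "endo scale A"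
    and B: "represents scale d s (upper_split_mat d \<theta>' \<phi>) B" "endo scale B"
    and distinct: "inj_on \<theta>' {..d}"
    and T: "endo scale T" "\<And>y. T (A y) = A (T y)" "\<And>y. T (B y) = B (T y)"
  obtains r where "\<And>y. T y = scale r y"
proof -
  have As: "A (s n) = scale (\<theta> n) (s n) + s (Suc n)" if n: "n < d" for n
  proof -
    have "A (s n) = (\<Sum>i\<le>d. scale (lower_split_mat d \<theta> $$ (i, n)) (s i))"
      using A(1) n by (simp add: represents_def)
    also have "\<dots> = scale (\<theta> n) (s n) + s (Suc n)"
      using n by (subst tridiagonal_column[where n = n]) (auto simp: lower_split_mat_def)
    finally show ?thesis .
  qed
  have Bs: "B (s n) = scale (\<theta>' n) (s n) + (if n = 0 then 0 else scale (\<phi> n) (s (n - 1)))"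
    if n: "n \<le> d" for n
  proof -
    have "B (s n) = (\<Sum>i\<le>d. scale (upper_split_mat d \<theta>' \<phi> $$ (i, n)) (s i))"
      using B(1) n by (simp add: represents_def)
    also have "\<dots> = scale (\<theta>' n) (s n) + (if n = 0 then 0 else scale (\<phi> n) (s (n - 1)))"
      using n by (subst tridiagonal_column[where n = n]) (auto simp: upper_split_mat_def)
    finally show ?thesis .
  qed
  let ?y = "T (s 0)" and ?c = "coord d s"
  have By: "B ?y = scale (\<theta>' 0) ?y"
    using T(3)[of "s 0"] Bs[of 0] by (simp add: endo_scale[OF T(1)])
  have c_eq: "\<theta>' 0 * ?c n ?y = \<theta>' n * ?c n ?y + (if n = d then 0 else \<phi> (Suc n) * ?c (Suc n) ?y)"
    if "n \<le> d" for n
    using coord_lowering[OF basis B(2) Bs that, of ?y] by (simp add: By coord_scale[OF basis])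
  have distinct': "\<theta>' 0 \<noteq> \<theta>' n" if "0 < n" "n \<le> d" for n
    using inj_onD[OF distinct, of 0 n] that by auto
  have c_zero: "?c n ?y = 0" if n: "0 < n" "n \<le> d" for n
    using n(2,1)
  proof (induction rule: inc_induct)
    case base
    then show ?case using c_eq[of d] distinct'[of d] by simp
  next
    case (step n)
    then show ?case using c_eq[of n] distinct'[of n] by simp
  qed
  define r where "r = ?c 0 ?y"
  have Ts0: "?y = scale r (s 0)"
  proof -
    have "?y = (\<Sum>n\<le>d. scale (?c n ?y) (s n))" by (rule coord_expansion[OF basis, symmetric])
    also have "\<dots> = (\<Sum>n\<le>d. if n = 0 then scale r (s 0) else 0)"
      by (intro sum.cong) (auto simp: c_zero r_def)
    finally show ?thesis by simp
  qed
  have Ts: "T (s n) = scale r (s n)" if "n \<le> d" for n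
    using that
  proof (induction n)
    case 0
    show ?case by (rule Ts0)
  next
    case (Suc n)
    then have IH: "T (s n) = scale r (s n)" by simp
    have s: "s (Suc n) = A (s n) - scale (\<theta> n) (s n)" using As[of n] Suc.prems by simp
    show ?case
      unfolding s endo_diff[OF T(1)] endo_scale[OF T(1)] T(2) IH endo_scale[OF A(2)]
      by (simp add: scale_right_diff_distrib scale_left_commute)
  qed
  have "endo scale (scale r)"
    by (rule endoI) (simp_all add: scale_right_distrib scale_left_commute)
  with that[of r] endo_eqI[OF basis T(1)] Ts show thesis by blast
qed

end

section \<open>The pair on a [1,3,0,2]-basis\<close>

context evaluation_module_space
begin

lemma ijkl_basis_multiple:
  assumes u: "ijkl_basis scale q x d 1 3 0 2 u" and r: "r \<noteq> 0"
    and u': "\<And>n. n \<le> d \<Longrightarrow> u' n = scale r (u n)"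
  shows "ijkl_basis scale q x d 1 3 0 2 u'"
proof -
  have sum: "(\<Sum>n\<le>d. u' n) = scale r (\<Sum>n\<le>d. u n)"
    by (simp add: u' scale_sum_right)
  have "is_basis scale d (\<lambda>n. scale r (u n))"
    using u r by (intro is_basis_rescale) (simp_all add: ijkl_basis_def)
  moreover have "u' ` {..d} = (\<lambda>n. scale r (u n)) ` {..d}"
    and "inj_on u' {..d} = inj_on (\<lambda>n. scale r (u n)) {..d}"
    using u' by (auto intro!: image_cong inj_on_cong)
  ultimately have "is_basis scale d u'" by (simp add: is_basis_def)
  then show ?thesis
    using u unfolding ijkl_basis_iff eigenbasis_def sum
    by (simp add: u' endo_scale[OF endo_generators(1)] endo_scale[OF endo_generators(2)] scale_left_commute)
qed

text \<open>The factor \<open>(q b)^n\<close> removes the parameter \<open>b\<close> from the off-diagonal entries of \<open>B\<close>, and in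
  those of \<open>A\<close> it cancels \<open>a b\<close> from \<open>t = a b / c\<close>, leaving \<open>c\<close> and its inverse.\<close>

lemma represents_tridiagonal_pair:
  assumes u: "ijkl_basis scale q x d 1 3 0 2 u"
    and nz: "a \<noteq> 0" "b \<noteq> 0" "c \<noteq> 0" and t: "t = a * b * inverse c"
    and v: "\<And>n. n \<le> d \<Longrightarrow> v n = scale ((q * b) ^ n) (u n)"
    and A: "\<And>w. A w = scale a (x 0 1 w) + scale (inverse a) (x 1 2 w)"
    and B: "\<And>w. B w = scale b (x 2 3 w) + scale (inverse b) (x 3 0 w)"
  shows "represents scale d v (A_tridiag q a c d) A" "represents scale d v (B_tridiag q b d) B"
proof -
  have t0: "t \<noteq> 0" using nz t by simp
  note actions = normalized_actions[OF u t0]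
  have split: "(if P then 0 else scale k y) = scale (if P then 0 else k) y" for P k y by simp
  have vS: "v (Suc n) = scale (q * b * (q * b) ^ n) (u (Suc n))" if "n < d" for n
    using v[of "Suc n"] that by simp
  have "A (v n) = (\<Sum>i\<le>d. scale (A_tridiag q a c d $$ (i, n)) (v i))" if n: "n \<le> d" for n
  proof -
    have lower: "scale (inverse a * (t * q * (1 - q powi (- 2 * int (Suc n))))) (scale ((q * b) ^ n) (u (Suc n)))
        = scale (A_tridiag q a c d $$ (Suc n, n)) (v (Suc n))" if "n \<noteq> d"
      using n that nz q_nonzero by (simp add: vS A_tridiag_def t field_simps)
    have upper: "scale (a * (inverse (t * q) * (1 - q powi (2 * int d - 2 * int n + 2)))) (scale ((q * b) ^ n) (u (n - 1)))
        = scale (A_tridiag q a c d $$ (n - 1, n)) (v (n - 1))" if "n \<noteq> 0"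
    proof -
      let ?y = "1 - q powi (2 * int d - 2 * int n + 2)"
      have entry: "A_tridiag q a c d $$ (n - 1, n) = c * ?y"
        using n that by (auto simp: A_tridiag_def)
      have "a * (inverse (t * q) * ?y) * (q * b) ^ n = c * ?y * (q * b) ^ (n - 1)"
        using nz q_nonzero that by (simp add: t power_eq_if[of "q * b" n] del: power_mult_distrib) (simp add: mult_ac)
      then show ?thesis using v[of "n - 1"] n by (simp only: entry scale_scale)
    qed
    have diag: "A_tridiag q a c d $$ (n, n) = (a + inverse a) * q powi (int d - 2 * int n)"
      using n by (simp add: A_tridiag_def)
    have "A (v n) = scale (A_tridiag q a c d $$ (n, n)) (v n)
        + (if n = d then 0 else scale (A_tridiag q a c d $$ (Suc n, n)) (v (Suc n)))
        + (if n = 0 then 0 else scale (A_tridiag q a c d $$ (n - 1, n)) (v (n - 1)))"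
      using lower upper n
      by (auto simp: A diag v[OF n] endo_scale[OF endo_generators(4)] endo_scale[OF endo_generators(6)]
          actions(3,4) scale_right_distrib scale_left_distrib distrib_left distrib_right mult_ac add_ac)
    also have "\<dots> = (\<Sum>i\<le>d. scale (A_tridiag q a c d $$ (i, n)) (v i))"
      using n by (intro tridiagonal_column[symmetric]) (auto simp: A_tridiag_def)
    finally show ?thesis .
  qed
  then show "represents scale d v (A_tridiag q a c d) A"
    by (simp add: represents_def A_tridiag_def)
  have "B (v n) = (\<Sum>i\<le>d. scale (B_tridiag q b d $$ (i, n)) (v i))" if n: "n \<le> d" for n
  proof -
    have lower: "scale (b * (q powi (- int d) * (1 - q powi (2 * int (Suc n))))) (scale ((q * b) ^ n) (u (Suc n)))
        = scale (B_tridiag q b d $$ (Suc n, n)) (v (Suc n))" if "n \<noteq> d"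
    proof -
      let ?y = "1 - q powi (2 * int (Suc n))"
      have entry: "B_tridiag q b d $$ (Suc n, n) = q powi (- int d - 1) * ?y"
        using n that by (auto simp: B_tridiag_def)
      have "b * (q powi (- int d) * ?y) * (q * b) ^ n = q powi (- int d - 1) * ?y * (q * b * (q * b) ^ n)"
        using q_nonzero by (simp add: power_int_diff del: power_mult_distrib)
      then show ?thesis using vS n that by (simp only: entry scale_scale)
    qed
    have upper: "scale (inverse b * (q powi int d * (1 - q powi (2 * int n - 2 * int d - 2)))) (scale ((q * b) ^ n) (u (n - 1)))
        = scale (B_tridiag q b d $$ (n - 1, n)) (v (n - 1))" if "n \<noteq> 0"
    proof -
      let ?y = "1 - q powi (2 * int n - 2 * int d - 2)"
      have entry: "B_tridiag q b d $$ (n - 1, n) = q powi (int d + 1) * ?y"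
        using n that by (auto simp: B_tridiag_def)
      have "inverse b * (q powi int d * ?y) * (q * b) ^ n = q powi (int d + 1) * ?y * (q * b) ^ (n - 1)"
        using nz q_nonzero that by (simp add: power_int_add power_eq_if[of "q * b" n] del: power_mult_distrib)
      then show ?thesis using v[of "n - 1"] n by (simp only: entry scale_scale)
    qed
    have diag: "B_tridiag q b d $$ (n, n) = (b + inverse b) * q powi (2 * int n - int d)"
      using n by (simp add: B_tridiag_def)
    have "B (v n) = scale (B_tridiag q b d $$ (n, n)) (v n)
        + (if n = d then 0 else scale (B_tridiag q b d $$ (Suc n, n)) (v (Suc n)))
        + (if n = 0 then 0 else scale (B_tridiag q b d $$ (n - 1, n)) (v (n - 1)))"
      using lower upper n
      by (auto simp: B diag v[OF n] endo_scale[OF endo_generators(1)] endo_scale[OF endo_generators(3)]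
          actions(1,2) scale_right_distrib scale_left_distrib distrib_left distrib_right mult_ac add_ac)
    also have "\<dots> = (\<Sum>i\<le>d. scale (B_tridiag q b d $$ (i, n)) (v i))"
      using n by (intro tridiagonal_column[symmetric]) (auto simp: B_tridiag_def)
    finally show ?thesis .
  qed
  then show "represents scale d v (B_tridiag q b d) B"
    by (simp add: represents_def B_tridiag_def)
qed

text \<open>A coincidence \<open>\<theta> i = \<theta> j\<close> forces \<open>b\<^sup>2 = q powi (2 (d - i - j))\<close>, which for \<open>i \<noteq> j\<close> the
  assumption on \<open>b\<^sup>2\<close> excludes.\<close>

lemma theta_inj_on:
  assumes b: "b \<noteq> 0" and "b\<^sup>2 \<notin> {q powi (2 * k) | k. 1 - int d \<le> k \<and> k \<le> int d - 1}"
  shows "inj_on (theta q b d) {..d}"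
proof (rule inj_onI, rule ccontr)
  fix i j assume ij: "i \<in> {..d}" "j \<in> {..d}" "theta q b d i = theta q b d j" "i \<noteq> j"
  let ?Q = "\<lambda>n. q powi (2 * int n - int d)"
  have Q: "?Q n \<noteq> 0" "q powi (int d - 2 * int n) = inverse (?Q n)" for n
    using q_nonzero by (simp_all flip: power_int_minus)
  have "?Q i \<noteq> ?Q j" using ij(4) by (simp add: q_powi_eq_iff)
  moreover have "(?Q i - ?Q j) * (b\<^sup>2 * (?Q i * ?Q j) - 1) = 0"
  proof -
    have factor: "(y - z) * (b\<^sup>2 * (y * z) - 1)
        = b * y * z * ((b * y + inverse b * inverse y) - (b * z + inverse b * inverse z))"
      if "y \<noteq> 0" "z \<noteq> 0" for y z
      using b that by (simp add: field_simps power2_eq_square)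
    show ?thesis
      unfolding factor[OF Q(1) Q(1)] using ij(3) unfolding theta_def Q(2) by simp
  qed
  ultimately have "(?Q i * ?Q j) * b\<^sup>2 = 1" by (simp add: mult.commute)
  then have "b\<^sup>2 = inverse (?Q i * ?Q j)" by (rule inverse_unique[symmetric])
  also have "\<dots> = q powi (2 * (int d - int i - int j))"
    using q_nonzero by (simp flip: power_int_add power_int_minus add: algebra_simps)
  finally have "b\<^sup>2 = q powi (2 * (int d - int i - int j))" .
  moreover have "1 - int d \<le> int d - int i - int j" "int d - int i - int j \<le> int d - 1"
    using ij by auto
  ultimately show False using assms(2) by blast
qed

end

theorem theorem17p7:
  fixes scale :: "'a::alg_closed_field \<Rightarrow> 'v::ab_group_add \<Rightarrow> 'v"
    and q a b c :: 'a
    and d :: nat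
    and A B :: "'v \<Rightarrow> 'v"
    and v :: "nat \<Rightarrow> 'v"
    and x :: "4 \<Rightarrow> 4 \<Rightarrow> 'v \<Rightarrow> 'v"
  assumes "vector_space scale"
    and "q \<noteq> 0"
    and "\<And>n::nat. n > 0 \<Longrightarrow> q ^ n \<noteq> 1"
    and "d \<ge> 1"
    and "q_Racah_Leonard_pair scale q a b c d A B"
    and "is_basis scale d v"
    and "evaluation_module_with_parameter scale q x d (a * b * inverse c)"
    and "\<And>w. A w = scale a (x 0 1 w) + scale (inverse a) (x 1 2 w)"
    and "\<And>w. B w = scale b (x 2 3 w) + scale (inverse b) (x 3 0 w)"
  shows "(represents scale d v (A_tridiag q a c d) A \<and>
          represents scale d v (B_tridiag q b d) B)
     \<longleftrightarrow> ijkl_basis scale q x d 1 3 0 2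
           (\<lambda>n. scale (q powi (- int n) * b powi (- int n)) (v n))"
proof -
  interpret vector_space scale by (rule assms(1))
  interpret evaluation_module_space scale q "a * b * inverse c" d x
    by unfold_locales (use assms in auto)
  have feasible: "feasible q a b c d" and endos: "endo scale A" "endo scale B"
    using assms(5) by (auto simp: q_Racah_Leonard_pair_def Leonard_pair_def)
  then have nz: "a \<noteq> 0" "b \<noteq> 0" "c \<noteq> 0" by (simp_all add: feasible_def)
  note pair = represents_tridiagonal_pair[OF _ nz refl _ assms(8,9)]
  have r: "(q * b) ^ n \<noteq> 0" "q powi (- int n) * b powi (- int n) = inverse ((q * b) ^ n)" for n
    using assms(2) nz by (simp_all add: power_int_minus power_mult_distrib)
  show ?thesis
  proof
    assume "ijkl_basis scale q x d 1 3 0 2 (\<lambda>n. scale (q powi (- int n) * b powi (- int n)) (v n))"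
    then have u: "ijkl_basis scale q x d 1 3 0 2 (\<lambda>n. scale (inverse ((q * b) ^ n)) (v n))"
      by (simp only: r(2))
    have "v n = scale ((q * b) ^ n) (scale (inverse ((q * b) ^ n)) (v n))" for n
      unfolding scale_scale right_inverse[OF r(1)] by simp
    then show "represents scale d v (A_tridiag q a c d) A \<and> represents scale d v (B_tridiag q b d) B"
      by (intro conjI pair[OF u])
  next
    assume v: "represents scale d v (A_tridiag q a c d) A \<and> represents scale d v (B_tridiag q b d) B"
    obtain u where u: "ijkl_basis scale q x d 1 3 0 2 u" using ijkl_basis_exists ..
    define v' where "v' n = scale ((q * b) ^ n) (u n)" for n
    have v': "represents scale d v' (A_tridiag q a c d) A" "represents scale d v' (B_tridiag q b d) B"
      using pair[OF u, of v'] by (simp_all add: v'_def)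
    have basis: "is_basis scale d v'"
      unfolding v'_def using u r(1) by (intro is_basis_rescale) (auto simp: ijkl_basis_def)
    obtain T where T: "endo scale T" "\<And>n. n \<le> d \<Longrightarrow> T (v' n) = v n"
      using ex_change_of_basis[OF basis] by blast
    have "T (A y) = A (T y)" "T (B y) = B (T y)" for y
      using represents_intertwine[OF basis v'(1) _ endos(1) T]
        represents_intertwine[OF basis v'(2) _ endos(2) T] v by blast+
    note commute = this
    obtain s where s: "is_basis scale d s"
      "represents scale d s (lower_split_mat d (theta q a d)) A"
      "represents scale d s (upper_split_mat d (theta q b d) (varphi_seq q a b c d)) B"
      using assms(5) unfolding q_Racah_Leonard_pair_def by blast
    have "b\<^sup>2 \<notin> {q powi (2 * k) | k. 1 - int d \<le> k \<and> k \<le> int d - 1}"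
      using feasible unfolding feasible_def by blast
    then have "inj_on (theta q b d) {..d}" by (rule theta_inj_on[OF nz(2)])
    then obtain k where k: "\<And>y. T y = scale k y"
      using split_form_centralizer[OF s(1,2) endos(1) s(3) endos(2) _ T(1) commute] by blast
    have vk: "v n = scale k (v' n)" if "n \<le> d" for n using T(2)[OF that] k by simp
    have "v 0 \<noteq> 0" by (rule basis_nonzero[OF assms(6)]) simp
    then have "k \<noteq> 0" using vk[of 0] by auto
    then show "ijkl_basis scale q x d 1 3 0 2 (\<lambda>n. scale (q powi (- int n) * b powi (- int n)) (v n))"
      unfolding r(2)
    proof (rule ijkl_basis_multiple[OF u])
      fix n assume n: "n \<le> d"
      have "inverse y * (k * y) = k" if "y \<noteq> 0" for y :: 'a using that by simp
      from this[OF r(1)[of n]]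
      show "scale (inverse ((q * b) ^ n)) (v n) = scale k (u n)"
        unfolding vk[OF n] v'_def scale_scale by (simp only:)
    qed
  qed
qed

end
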